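(* Let $k,n\ge1$ be integers and let $G,H\in\mathbb{F}_q[x]$ with $H\neq0$ and $H^k\nmid G$. Let $A$ be the monic polynomial with $A^k=(G,H^k)_k$, $N=H/A$, $m=\deg H$, $m_1=\deg A$. Then $$(-1)^{m-m_1}\frac{\phi_k^{(n)}(N)}{\phi_k^{(n)}(H)}\,\eta_k^{(n)}(G,H)=\left((-1)^{m-m_1}\frac{\phi_k(N)}{\phi_k(H)}\,\eta_k(G,H)\right)^{n}.$$
   Context: Let $\mathbb{F}_q$ be a finite field with $q$ elements and fix a non-trivial homomorphism $\lambda:(\mathbb{F}_q,+)\to\mathbb{C}^*$. For nonzero $M\in\mathbb{F}_q[x]$ of degree $m\ge1$ and $B\in\mathbb{F}_q[x]$, let $t_M(B)$ be the coefficient of $x^{m-1}$ in the remainder of $B$ on division by $M$ (if $m=0$, $t_M(B)=0$), and $E(G,M)(B)=\lambda(t_M(GB))$. For polynomials $A,B$ (over $\mathbb{F}_q$ or over $\mathbb{F}_{q^n}$) not both zero, $(A,B)_k$ is the monic polynomial of the form $C^k$ of largest degree dividing both. For nonzero $H\in\mathbb{F}_q[x]$, $\eta_k(G,H)=\sum_{D}E(G,H^k)(D)$, $D$ over a complete residue system modulo $H^k$ in $\mathbb{F}_q[x]$ with $(D,H^k)_k=1$. Let $\mathrm{Tr}:\mathbb{F}_{q^n}[x]\to\mathbb{F}_q[x]$ be the trace $\mathrm{Tr}(D)=\sum_{i=1}^n\sigma^i(D)$, where $\sigma$ raises each coefficient to the $q$-th power. Define $\eta_k^{(n)}(G,H)=\sum_{D}E(G,H^k)(\mathrm{Tr}(D))$,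 where $D$ runs over a complete residue system modulo $H^k$ in $\mathbb{F}_{q^n}[x]$ with $(D,H^k)_k=1$ computed in $\mathbb{F}_{q^n}[x]$. $|B|=q^{\deg B}$; $\phi_k(H)=|H|^k\prod_P(1-|P|^{-k})$ over monic irreducible $P\in\mathbb{F}_q[x]$ dividing $H$; $\phi_k^{(n)}(H)=q^{nk\deg H}\prod_{Q}(1-q^{-nk\deg Q})$ over monic irreducible $Q\in\mathbb{F}_{q^n}[x]$ dividing $H$. *)

theory Defs
  imports
    Complex_Main
    "HOL-Library.Cardinality"
    "HOL-Computational_Algebra.Polynomial_Factorial"
    "HOL-Number_Theory.Cong"
begin

text \<open>
  The field with q elements is a type 'a of class finite_field, so q = CARD('a); its extension of
  degree n is a type 'b of the same class with CARD('b) = q ^ n, together with an embedding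
  of 'a into 'b.
\<close>

definition field_embedding :: "('a::field \<Rightarrow> 'b::field) \<Rightarrow> bool" where
  "field_embedding \<iota> \<longleftrightarrow>
     \<iota> 1 = 1 \<and> (\<forall>x y. \<iota> (x + y) = \<iota> x + \<iota> y) \<and> (\<forall>x y. \<iota> (x * y) = \<iota> x * \<iota> y)"

definition nontrivial_additive_character :: "('a::field \<Rightarrow> complex) \<Rightarrow> bool" where
  "nontrivial_additive_character lam \<longleftrightarrow>
     (\<forall>x. lam x \<noteq> 0) \<and> (\<forall>x y. lam (x + y) = lam x * lam y) \<and> (\<exists>x. lam x \<noteq> 1)"

definition t_coeff :: "'a::field poly \<Rightarrow> 'a poly \<Rightarrow> 'a" where
  "t_coeff M B = (if degree M = 0 then 0 else coeff (B mod M) (degree M - 1))"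

definition E_char :: "('a::field \<Rightarrow> complex) \<Rightarrow> 'a poly \<Rightarrow> 'a poly \<Rightarrow> 'a poly \<Rightarrow> complex" where
  "E_char lam G M B = lam (t_coeff M (G * B))"

definition monic_common_kth_power :: "nat \<Rightarrow> 'a::field poly \<Rightarrow> 'a poly \<Rightarrow> 'a poly \<Rightarrow> bool" where
  "monic_common_kth_power k A B D \<longleftrightarrow>
     lead_coeff D = 1 \<and> (\<exists>C. D = C ^ k) \<and> D dvd A \<and> D dvd B"

definition kgcd :: "nat \<Rightarrow> 'a::field poly \<Rightarrow> 'a poly \<Rightarrow> 'a poly" where
  "kgcd k A B =
     (THE D. monic_common_kth_power k A B D \<and>
        (\<forall>D'. monic_common_kth_power k A B D' \<longrightarrow> degree D' \<le> degree D))"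

definition complete_residue_system :: "'a::field poly \<Rightarrow> 'a poly set \<Rightarrow> bool" where
  "complete_residue_system M R \<longleftrightarrow> (\<forall>B. \<exists>!D. D \<in> R \<and> [B = D] (mod M))"

text \<open>
  The sums below take the complete residue system as an explicit argument; their values do not
  depend on its choice.
\<close>

definition eta :: "('a::field \<Rightarrow> complex) \<Rightarrow> nat \<Rightarrow> 'a poly set \<Rightarrow> 'a poly \<Rightarrow> 'a poly \<Rightarrow> complex" where
  "eta lam k R G H = (\<Sum>D \<in> {D \<in> R. kgcd k D (H ^ k) = 1}. E_char lam G (H ^ k) D)"

definition frob :: "nat \<Rightarrow> 'b::field poly \<Rightarrow> 'b poly" where
  "frob q = map_poly (\<lambda>c. c ^ q)"

text \<open>
  The sum of the conjugates has coefficients in the image of \<open>\<iota>\<close>; the trace is its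
  preimage, which is unique because \<open>\<iota>\<close> is injective.
\<close>

definition poly_trace :: "('a::finite_field \<Rightarrow> 'b::finite_field) \<Rightarrow> nat \<Rightarrow> 'b poly \<Rightarrow> 'a poly" where
  "poly_trace \<iota> n D = (THE T. map_poly \<iota> T = (\<Sum>i=1..n. (frob CARD('a) ^^ i) D))"

definition eta_ext ::
  "('a::finite_field \<Rightarrow> complex) \<Rightarrow> ('a \<Rightarrow> 'b::finite_field) \<Rightarrow> nat \<Rightarrow> nat \<Rightarrow> 'b poly set \<Rightarrow>
     'a poly \<Rightarrow> 'a poly \<Rightarrow> complex" where
  "eta_ext lam \<iota> n k S G H =
     (\<Sum>D \<in> {D \<in> S. kgcd k D (map_poly \<iota> (H ^ k)) = 1}. E_char lam G (H ^ k) (poly_trace \<iota> n D))"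

definition pabs :: "'a::finite_field poly \<Rightarrow> real" where
  "pabs B = real CARD('a) ^ degree B"

definition phi :: "nat \<Rightarrow> 'a::finite_field poly \<Rightarrow> real" where
  "phi k H = pabs H ^ k * (\<Prod>P \<in> {P. lead_coeff P = 1 \<and> irreducible P \<and> P dvd H}. 1 - 1 / pabs P ^ k)"

definition phi_ext :: "('a::finite_field \<Rightarrow> 'b::finite_field) \<Rightarrow> nat \<Rightarrow> nat \<Rightarrow> 'a poly \<Rightarrow> real" where
  "phi_ext \<iota> n k H =
     real CARD('a) ^ (n * k * degree H) *
     (\<Prod>Q \<in> {Q. lead_coeff Q = 1 \<and> irreducible Q \<and> Q dvd map_poly \<iota> H}.
        1 - 1 / real CARD('a) ^ (n * k * degree Q))"

end

theory Submission
  imports "HOL-Algebra.Algebraic_Closure_Type" Defs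
begin

text \<open>
  Write \<open>\<mu>\<close> for the Moebius function of polynomials. Expanding the condition that no \<open>P ^ k\<close>
  with \<open>P\<close> prime and \<open>P dvd H\<close> divides \<open>D\<close> over the subsets of the prime divisors of \<open>H\<close>, and
  evaluating the resulting complete character sums, gives Hoelder's formula
  \<open>\<phi>\<^sub>k(N) \<eta>\<^sub>k(G, H) = \<phi>\<^sub>k(H) \<mu>(N)\<close>. Over the extension field the sum \<open>\<eta>\<^sub>k\<^sup>(\<^sup>n\<^sup>)(G, H)\<close> is
  \<open>\<eta>\<^sub>k\<close> for the character \<open>\<lambda>\<close> composed with the trace, and \<open>A\<close> does not change under the extension
  by Galois descent, so the same formula applies there. Both sides are thus values of \<open>\<mu>\<close> at \<open>N\<close>,
  and they match because a prime of degree \<open>d\<close> splits into \<open>gcd n d\<close> distinct primes over the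
  extension, where \<open>d + gcd n d\<close> and \<open>n (d + 1)\<close> have the same parity.
\<close>

section \<open>Polynomials over a field\<close>

text \<open>A nonzero element of least degree in the ideal generated by \<open>p\<close> and
  \<open>q\<close> divides every element of it, since remainders stay in the ideal and have smaller
  degree.\<close>

lemma poly_bezout:
  fixes p q :: "'a::field poly"
  obtains g u v where "g = u * p + v * q" "g dvd p" "g dvd q"
proof (cases "p = 0 \<and> q = 0")
  case True
  then show ?thesis using that[of 0 0 0] by simp
next
  case False
  define I where "I = {u * p + v * q | u v. True}"
  have mod_I: "a mod b \<in> I" if aI: "a \<in> I" and bI: "b \<in> I" for a b
  proof -
    obtain u v where *: "a = u * p + v * q" using aI unfolding I_def by auto
    obtain u' v' where **: "b = u' * p + v' * q" using bI unfolding I_def by auto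
    define c where "c = a div b"
    have "a mod b = a - c * b"
      by (simp add: minus_div_mult_eq_mod c_def)
    also have "\<dots> = (u - c * u') * p + (v - c * v') * q"
      by (simp add: * ** algebra_simps)
    finally show ?thesis unfolding I_def by auto
  qed
  have "p = 1 * p + 0 * q" "q = 0 * p + 1 * q" by simp_all
  then have pI: "p \<in> I" and qI: "q \<in> I" unfolding I_def by blast+
  then have "\<exists>g. g \<in> I \<and> g \<noteq> 0" using False by blast
  then obtain g where g: "g \<in> I" "g \<noteq> 0" and min: "\<And>h. h \<in> I \<and> h \<noteq> 0 \<Longrightarrow> degree g \<le> degree h"
    using ex_has_least_nat[of "\<lambda>g. g \<in> I \<and> g \<noteq> 0" _ degree] by blast
  have "g dvd h" if "h \<in> I" for h
  proof (rule ccontr)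
    assume "\<not> g dvd h"
    then have "h mod g \<noteq> 0" by (simp add: dvd_eq_mod_eq_0)
    then show False
      using min[of "h mod g"] mod_I[OF that g(1)] degree_mod_less'[OF g(2), of h] by simp
  qed
  moreover obtain u v where "g = u * p + v * q" using g(1) unfolding I_def by auto
  ultimately show ?thesis using that pI qI by blast
qed

text \<open>An identity, unlike the absence of common factors, can be multiplied, evaluated at a
  point and carried along a field embedding; the later coprimality arguments rest on this.\<close>

lemma coprime_poly_iff_bezout:
  fixes p q :: "'a::field poly"
  shows "coprime p q \<longleftrightarrow> (\<exists>u v. u * p + v * q = 1)"
proof
  assume cop: "coprime p q"
  obtain g u v where g: "g = u * p + v * q" "g dvd p" "g dvd q" by (rule poly_bezout)
  have "is_unit g" using cop g by (auto simp: coprime_def)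
  then obtain h where "1 = g * h" by (elim dvdE)
  then have "(h * u) * p + (h * v) * q = 1" by (simp add: g(1) algebra_simps)
  then show "\<exists>u v. u * p + v * q = 1" by blast
next
  assume "\<exists>u v. u * p + v * q = 1"
  then obtain u v where uv: "u * p + v * q = 1" by blast
  show "coprime p q"
  proof (rule coprimeI)
    fix c assume "c dvd p" "c dvd q"
    then have "c dvd u * p + v * q" by simp
    then show "is_unit c" using uv by simp
  qed
qed

text \<open>Multiply the two Bezout identities and collect the multiples of
  \<open>r\<close>.\<close>

lemma coprime_poly_mult:
  fixes p q r :: "'a::field poly"
  assumes "coprime p r" "coprime q r"
  shows "coprime (p * q) r"
proof -
  obtain u v u' v' where 1: "u * p + v * r = 1" and 2: "u' * q + v' * r = 1"
    using assms by (auto simp: coprime_poly_iff_bezout)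
  have "(u * u') * (p * q) + (u * p * v' + v * u' * q + v * v' * r) * r
      = (u * p + v * r) * (u' * q + v' * r)" by (simp add: algebra_simps)
  then show ?thesis using 1 2 by (auto simp: coprime_poly_iff_bezout)
qed

lemma coprime_poly_power:
  fixes p r :: "'a::field poly"
  shows "coprime p r \<Longrightarrow> coprime (p ^ k) r"
  by (induction k) (auto intro: coprime_poly_mult)

lemma coprime_poly_powers:
  fixes p r :: "'a::field poly"
  assumes "coprime p r"
  shows "coprime (p ^ k) (r ^ l)"
  using coprime_poly_power[of r "p ^ k" l] coprime_poly_power[OF assms, of k]
  by (simp add: coprime_commute)

lemma coprime_poly_prod:
  fixes f :: "'i \<Rightarrow> 'a::field poly"
  shows "(\<And>x. x \<in> Y \<Longrightarrow> coprime (f x) r) \<Longrightarrow> coprime (prod f Y) r"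
  by (induction Y rule: infinite_finite_induct) (auto intro: coprime_poly_mult)

lemma coprime_poly_dvd_mult:
  fixes p q r :: "'a::field poly"
  assumes "coprime p q" "p dvd q * r"
  shows "p dvd r"
proof -
  obtain u v where uv: "u * p + v * q = 1" using assms by (auto simp: coprime_poly_iff_bezout)
  have "r = (u * p + v * q) * r" by (simp add: uv)
  also have "\<dots> = p * (u * r) + v * (q * r)" by (simp add: algebra_simps)
  finally show ?thesis using assms(2) by (metis dvd_add dvd_mult dvd_triv_left)
qed

lemma coprime_poly_mult_dvd:
  fixes p q r :: "'a::field poly"
  assumes "coprime p q" "p dvd r" "q dvd r"
  shows "p * q dvd r"
proof -
  obtain s where s: "r = q * s" using assms(3) by (elim dvdE)
  have "p dvd s" using coprime_poly_dvd_mult[OF assms(1), of s] assms(2) s by simp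
  then show ?thesis using s by (simp add: mult.commute mult_dvd_mono)
qed

lemma prod_coprime_poly_dvd:
  fixes f :: "'i \<Rightarrow> 'a::field poly"
  assumes "finite Y" "\<And>x y. x \<in> Y \<Longrightarrow> y \<in> Y \<Longrightarrow> x \<noteq> y \<Longrightarrow> coprime (f x) (f y)"
    and "\<And>x. x \<in> Y \<Longrightarrow> f x dvd r"
  shows "prod f Y dvd r"
  using assms
proof (induction Y rule: finite_induct)
  case (insert x Y)
  have "coprime (prod f Y) (f x)"
    using insert.hyps insert.prems(1) by (intro coprime_poly_prod) auto
  moreover have "prod f Y dvd r"
    using insert.IH insert.prems by blast
  ultimately have "prod f Y * f x dvd r"
    using insert.prems(2) by (intro coprime_poly_mult_dvd) auto
  then show ?case using insert.hyps by (simp add: mult.commute)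
qed simp

lemma irreducible_poly_coprime:
  fixes P N :: "'a::field poly"
  assumes "irreducible P" "\<not> P dvd N"
  shows "coprime P N"
proof (rule coprimeI)
  fix c assume c: "c dvd P" "c dvd N"
  have "P dvd c \<or> is_unit c" using irreducibleD'[OF assms(1) c(1)] .
  then show "is_unit c" using c(2) assms(2) dvd_trans by blast
qed

lemma monic_dvd_degree_imp_eq:
  fixes p q :: "'a::field poly"
  assumes "lead_coeff p = 1" "lead_coeff q = 1" "p dvd q" "degree q \<le> degree p"
  shows "p = q"
proof -
  obtain r where r: "q = p * r" using assms(3) by (elim dvdE)
  have nz: "p \<noteq> 0" "q \<noteq> 0" using assms(1,2) by auto
  then have "degree r = 0" using r assms(4) by (auto simp: degree_mult_eq)
  moreover have "lead_coeff r = 1" using assms(1,2) r by (simp add: lead_coeff_mult)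
  ultimately have "r = 1" by (metis degree_eq_zeroE lead_coeff_pCons(2) one_pCons)
  then show ?thesis using r by simp
qed

lemma monic_dvd_antisym:
  fixes p q :: "'a::field poly"
  assumes "lead_coeff p = 1" "lead_coeff q = 1" "p dvd q" "q dvd p"
  shows "p = q"
proof -
  have "p \<noteq> 0" using assms(1) by auto
  then show ?thesis using assms dvd_imp_degree_le by (intro monic_dvd_degree_imp_eq) auto
qed

lemma monic_irreducible_dvd_imp_eq:
  fixes P Q :: "'a::field poly"
  assumes "lead_coeff P = 1" "irreducible P" "lead_coeff Q = 1" "irreducible Q" "P dvd Q"
  shows "P = Q"
proof -
  have "Q dvd P" using irreducibleD'[OF assms(4,5)] irreducible_not_unit[OF assms(2)] by blast
  then show ?thesis using assms by (intro monic_dvd_antisym) auto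
qed

section \<open>Monic irreducible divisors and the radical\<close>

definition monic_primes :: "'a::field poly \<Rightarrow> 'a poly set" where
  "monic_primes H = {P. lead_coeff P = 1 \<and> irreducible P \<and> P dvd H}"

text \<open>Squarefreeness of a nonzero \<open>N\<close> is expressed below as
  \<open>N dvd poly_radical N\<close>.\<close>

definition poly_radical :: "'a::field poly \<Rightarrow> 'a poly" where
  "poly_radical H = \<Prod>(monic_primes H)"

lemma monic_primesD:
  assumes "P \<in> monic_primes H"
  shows "lead_coeff P = 1" "irreducible P" "P dvd H" "P \<noteq> 0"
  using assms by (auto simp: monic_primes_def)

lemma coprime_monic_primes:
  assumes "P \<in> monic_primes H" "Q \<in> monic_primes K" "P \<noteq> Q"
  shows "coprime P Q"
proof (rule irreducible_poly_coprime)
  show "irreducible P" using assms(1) by (rule monic_primesD)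
  show "\<not> P dvd Q"
    using assms monic_irreducible_dvd_imp_eq[of P Q] by (auto simp: monic_primes_def)
qed

lemma degree_irreducible_pos:
  fixes P :: "'a::field poly"
  assumes "irreducible P" shows "degree P > 0"
proof (rule ccontr)
  assume "\<not> degree P > 0"
  moreover have "P \<noteq> 0" using assms by auto
  ultimately show False
    using irreducible_not_unit[OF assms] by (simp add: is_unit_iff_degree)
qed

text \<open>A nonconstant divisor of least degree cannot split further, and scaling makes it
  monic.\<close>

lemma exists_monic_prime:
  fixes N :: "'a::field poly"
  assumes "degree N > 0"
  obtains P where "P \<in> monic_primes N"
proof -
  let ?S = "\<lambda>P. P dvd N \<and> degree P > 0"
  have "?S N" using assms by simp
  then obtain P where P: "P dvd N" "degree P > 0" and min: "\<And>R. ?S R \<Longrightarrow> degree P \<le> degree R"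
    using ex_has_least_nat[of ?S N degree] by blast
  have P0: "P \<noteq> 0" using P by auto
  have "irreducible P"
  proof (rule irreducibleI)
    show "P \<noteq> 0" by fact
    show "\<not> is_unit P" using P P0 by (simp add: is_unit_iff_degree)
    fix a b assume ab: "P = a * b"
    then have nz: "a \<noteq> 0" "b \<noteq> 0" using P0 by auto
    then have deg: "degree P = degree a + degree b" using ab by (simp add: degree_mult_eq)
    show "is_unit a \<or> is_unit b"
    proof (rule ccontr)
      assume *: "\<not> (is_unit a \<or> is_unit b)"
      then have "degree a > 0" "degree b > 0" using nz by (simp_all add: is_unit_iff_degree)
      moreover have "a dvd N" using ab P(1) by (metis dvd_mult_left)
      ultimately show False using min[of a] deg by simp
    qed
  qed
  define c where "c = inverse (lead_coeff P)"
  have c: "c \<noteq> 0" using P0 by (simp add: c_def)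
  have "irreducible (smult c P)"
    using \<open>irreducible P\<close> c irreducible_mult_unit_left[of "[:c:]" P] is_unit_triv[OF c] by simp
  moreover have "smult c P dvd N" using P(1) c by (simp add: smult_dvd_iff)
  moreover have "lead_coeff (smult c P) = 1" using P0 by (simp add: c_def)
  ultimately show ?thesis using that[of "smult c P"] by (simp add: monic_primes_def)
qed

text \<open>Separates a condition on \<open>Y\<close> from squarefreeness of \<open>N\<close>, which
  does not involve \<open>Y\<close>. A prime of \<open>N\<close> outside \<open>Y\<close> would be
  coprime to the product, and the members of \<open>Y\<close> that do not divide \<open>N\<close>
  are coprime to \<open>N\<close> and cancel.\<close>

lemma dvd_prod_monic_irreducible_iff:
  fixes N :: "'a::field poly"
  assumes "finite Y" "\<And>P. P \<in> Y \<Longrightarrow> lead_coeff P = 1 \<and> irreducible P"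
  shows "N dvd \<Prod>Y \<longleftrightarrow> monic_primes N \<subseteq> Y \<and> N dvd poly_radical N"
proof (intro iffI conjI)
  assume N: "N dvd \<Prod>Y"
  show sub: "monic_primes N \<subseteq> Y"
  proof
    fix P assume P: "P \<in> monic_primes N"
    then have "P dvd \<Prod>Y" using N monic_primesD(3) dvd_trans by blast
    show "P \<in> Y"
    proof (rule ccontr)
      assume "P \<notin> Y"
      then have "coprime Q P" if "Q \<in> Y" for Q
        using that assms(2)[OF that] P coprime_monic_primes[of Q Q P N]
        by (auto simp: monic_primes_def)
      then have "coprime (\<Prod>Y) P" by (intro coprime_poly_prod) auto
      then have "is_unit P" using \<open>P dvd \<Prod>Y\<close> by (simp add: coprime_def)
      then show False using irreducible_not_unit[OF monic_primesD(2)[OF P]] by blast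
    qed
  qed
  have "coprime (\<Prod>(Y - monic_primes N)) N"
    using assms(2) by (intro coprime_poly_prod irreducible_poly_coprime) (auto simp: monic_primes_def)
  moreover have "\<Prod>Y = \<Prod>(Y - monic_primes N) * poly_radical N"
    unfolding poly_radical_def using assms(1) sub by (rule prod.subset_diff[rotated])
  ultimately show "N dvd poly_radical N"
    using N coprime_poly_dvd_mult by (metis coprime_commute)
next
  assume *: "monic_primes N \<subseteq> Y \<and> N dvd poly_radical N"
  then have "poly_radical N dvd \<Prod>Y"
    unfolding poly_radical_def using assms(1) by (intro prod_dvd_prod_subset) auto
  then show "N dvd \<Prod>Y" using * dvd_trans by blast
qed

lemma poly_radical_dvd: "finite (monic_primes N) \<Longrightarrow> poly_radical N dvd N"
  unfolding poly_radical_def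
  by (rule prod_coprime_poly_dvd) (blast intro: coprime_monic_primes monic_primesD(3))+

lemma lead_coeff_poly_radical: "lead_coeff (poly_radical N) = 1"
  unfolding poly_radical_def lead_coeff_prod by (rule prod.neutral) (simp add: monic_primes_def)

text \<open>A condition on coefficients rather than on the degree, because the residues modulo a
  constant are \<open>{0}\<close> although \<open>degree 0 < 0\<close> fails.\<close>

definition polys_below :: "nat \<Rightarrow> 'a::zero poly set" where
  "polys_below n = {p. \<forall>i\<ge>n. coeff p i = 0}"

lemma polys_below_Suc: "polys_below (Suc n) = (\<lambda>(a, p). pCons a p) ` (UNIV \<times> polys_below n)"
proof (intro equalityI subsetI)
  fix p :: "'a poly" assume p: "p \<in> polys_below (Suc n)"
  obtain a r where pr: "p = pCons a r" by (cases p)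
  have "coeff r i = 0" if "i \<ge> n" for i
    using p that unfolding pr polys_below_def by (auto dest: spec[of _ "Suc i"])
  then show "p \<in> (\<lambda>(a, p). pCons a p) ` (UNIV \<times> polys_below n)"
    unfolding pr polys_below_def by auto
qed (auto simp: polys_below_def coeff_pCons split: nat.split)

lemma finite_card_polys_below:
  "finite (polys_below n :: 'a::{finite,zero} poly set)
   \<and> card (polys_below n :: 'a poly set) = CARD('a) ^ n"
proof (induction n)
  case 0
  have "polys_below 0 = {0 :: 'a poly}" by (auto simp: polys_below_def poly_eq_iff)
  then show ?case by simp
next
  case (Suc n)
  have "inj_on (\<lambda>(a, p). pCons a p) (UNIV \<times> (polys_below n :: 'a poly set))"
    by (auto simp: inj_on_def)
  then show ?case
    using Suc by (simp add: polys_below_Suc card_image card_cartesian_product)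
qed

lemma mod_eq_self_iff_polys_below:
  fixes U :: "'a::field poly"
  assumes "U \<noteq> 0"
  shows "D mod U = D \<longleftrightarrow> D \<in> polys_below (degree U)"
proof
  assume "D mod U = D"
  then have "D = 0 \<or> degree D < degree U" using degree_mod_less[OF assms, of D] by simp
  then show "D \<in> polys_below (degree U)" by (auto simp: polys_below_def coeff_eq_0)
next
  assume D: "D \<in> polys_below (degree U)"
  show "D mod U = D"
  proof (cases "D = 0")
    case False
    then have "degree D < degree U"
      using D leading_coeff_neq_0[OF False] unfolding polys_below_def
      by (metis (mono_tags, lifting) mem_Collect_eq not_le)
    then show ?thesis by (rule mod_poly_less)
  qed simp
qed

lemma finite_monic_primes:
  fixes H :: "'a::finite_field poly"
  assumes "H \<noteq> 0"
  shows "finite (monic_primes H)"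
proof (rule finite_subset)
  show "monic_primes H \<subseteq> polys_below (Suc (degree H))"
    using assms
    by (auto simp: monic_primes_def polys_below_def Suc_le_eq intro!: coeff_eq_0
             dest: dvd_imp_degree_le)
qed (use finite_card_polys_below in blast)

section \<open>Greatest common k-th power divisors\<close>

text \<open>With \<open>c\<close> and \<open>e\<close> coprime, \<open>g * c * e\<close> is a least
  common multiple of \<open>g * c\<close> and \<open>g * e\<close>, so the k-th roots of divisors of
  \<open>B\<close> are closed under least common multiples.\<close>

lemma lcm_power_dvd:
  fixes c e g :: "'a::field poly"
  assumes "g \<noteq> 0" "coprime c e" "(g * c) ^ k dvd B" "(g * e) ^ k dvd B"
  shows "(g * c * e) ^ k dvd B"
proof -
  have "g ^ k dvd B" using assms(3) by (metis dvd_mult_left power_mult_distrib)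
  then obtain B' where B': "B = g ^ k * B'" by (elim dvdE)
  have "c ^ k dvd B'" "e ^ k dvd B'"
    using assms(1,3,4) by (auto simp: B' power_mult_distrib)
  then have "c ^ k * e ^ k dvd B'"
    using coprime_poly_powers[OF assms(2)] by (intro coprime_poly_mult_dvd)
  then show ?thesis
    by (simp add: B' power_mult_distrib mult.assoc)
qed

text \<open>Replaces maximality of the degree, which defines \<open>kgcd\<close>, by a universal
  property for divisibility; this also shows that the description in \<open>kgcd\<close> denotes a
  unique polynomial.\<close>

lemma kgcd_props:
  fixes A B :: "'a::field poly"
  assumes "k \<ge> 1" "B \<noteq> 0"
  obtains C where "lead_coeff C = 1" "kgcd k A B = C ^ k" "C ^ k dvd A" "C ^ k dvd B"
    "\<And>E. E ^ k dvd A \<Longrightarrow> E ^ k dvd B \<Longrightarrow> E dvd C"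
proof -
  define S where "S = (\<lambda>C. C ^ k dvd A \<and> C ^ k dvd B)"
  \<comment> \<open>The bound, which rests on \<open>k \<ge> 1\<close> and
    \<open>B \<noteq> 0\<close>, yields a candidate \<open>C0\<close> of maximal degree.\<close>
  have bound: "C \<noteq> 0 \<and> degree C \<le> degree B" if "S C" for C
  proof -
    have "C ^ k \<noteq> 0" using that assms(2) by (auto simp: S_def)
    then have "C \<noteq> 0" using assms(1) by (auto simp: power_0_left)
    moreover have "degree (C ^ k) \<le> degree B"
      using that assms(2) by (auto simp: S_def intro: dvd_imp_degree_le)
    moreover have "1 * degree C \<le> k * degree C" using assms(1) by (rule mult_right_mono) simp
    ultimately show ?thesis by (metis degree_power_eq mult_1 order_trans)
  qed
  have "S 1" by (simp add: S_def)
  moreover have "\<forall>C. S C \<longrightarrow> degree C < Suc (degree B)" using bound by (simp add: less_Suc_eq_le)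
  ultimately obtain C0 where C0: "S C0" and max: "\<And>E. S E \<Longrightarrow> degree E \<le> degree C0"
    using ex_has_greatest_nat[of S 1 degree "Suc (degree B)"] by blast
  have univ: "E dvd C0" if E: "S E" for E
  proof -
    obtain g u v where g: "g = u * C0 + v * E" "g dvd C0" "g dvd E" by (rule poly_bezout)
    obtain c e where c: "C0 = g * c" and e: "E = g * e" using g(2,3) by (elim dvdE)
    have nz: "g \<noteq> 0" "e \<noteq> 0" "C0 \<noteq> 0" using bound[OF C0] bound[OF E] c e by auto
    have "g * (u * c + v * e) = g * 1" using g(1) c e by (simp add: algebra_simps)
    then have "u * c + v * e = 1" using nz(1) by (metis mult_cancel_left)
    then have "coprime c e" by (auto simp: coprime_poly_iff_bezout)
    \<comment> \<open>\<open>C0 * e\<close> is a least common multiple of \<open>C0\<close> and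
      \<open>E\<close>; maximality of \<open>C0\<close> forces \<open>e\<close> to be a
      unit.\<close>
    then have "S (C0 * e)"
      using C0 E lcm_power_dvd[OF nz(1)] unfolding S_def c e by blast
    then have "degree C0 + degree e \<le> degree C0" using max nz by (metis degree_mult_eq)
    then have "is_unit e" using nz by (simp add: is_unit_iff_degree)
    then have "E dvd g" using e by (simp add: mult_unit_dvd_iff)
    then show ?thesis using g(2) dvd_trans by blast
  qed
  define C where "C = smult (inverse (lead_coeff C0)) C0"
  have lc: "lead_coeff C0 \<noteq> 0" using bound[OF C0] by simp
  have monic: "lead_coeff C = 1" using lc by (simp add: C_def)
  have SC: "S C" using C0 lc by (simp add: S_def C_def smult_power smult_dvd_iff)
  have univ': "E dvd C" if "S E" for E
    using univ[OF that] unfolding C_def by (rule dvd_smult)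
  have "kgcd k A B = C ^ k"
    unfolding kgcd_def
  proof (rule the_equality)
    have "degree D' \<le> degree (C ^ k)" if D': "monic_common_kth_power k A B D'" for D'
    proof -
      obtain E where E: "D' = E ^ k" using D' by (auto simp: monic_common_kth_power_def)
      then have "S E" using D' by (auto simp: monic_common_kth_power_def S_def)
      then have "D' dvd C ^ k" unfolding E by (intro dvd_power_same univ')
      then show ?thesis using bound[OF SC] by (intro dvd_imp_degree_le) auto
    qed
    then show "monic_common_kth_power k A B (C ^ k) \<and>
        (\<forall>D'. monic_common_kth_power k A B D' \<longrightarrow> degree D' \<le> degree (C ^ k))"
      using SC monic by (auto simp: monic_common_kth_power_def S_def lead_coeff_power)
  next
    fix D assume D: "monic_common_kth_power k A B D \<and>
      (\<forall>D'. monic_common_kth_power k A B D' \<longrightarrow> degree D' \<le> degree D)"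
    obtain E where E: "D = E ^ k" using D by (auto simp: monic_common_kth_power_def)
    then have "S E" using D by (auto simp: monic_common_kth_power_def S_def)
    then have "D dvd C ^ k" unfolding E by (intro dvd_power_same univ')
    moreover have "monic_common_kth_power k A B (C ^ k)"
      using SC monic by (auto simp: monic_common_kth_power_def S_def lead_coeff_power)
    then have "degree (C ^ k) \<le> degree D" using D by blast
    moreover have "lead_coeff D = 1" using D by (simp add: monic_common_kth_power_def)
    ultimately show "D = C ^ k"
      using monic by (intro monic_dvd_degree_imp_eq) (simp_all add: lead_coeff_power)
  qed
  then show ?thesis using that[of C] SC univ' monic unfolding S_def by blast
qed

text \<open>After cancelling a greatest common divisor, \<open>a ^ k\<close> divides the coprime
  \<open>c ^ k\<close>, hence is a unit.\<close>

lemma power_dvd_power_imp_dvd: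
  fixes A C :: "'a::field poly"
  assumes "k \<ge> 1" "C \<noteq> 0" "A ^ k dvd C ^ k"
  shows "A dvd C"
proof -
  obtain g u v where g: "g = u * A + v * C" "g dvd A" "g dvd C" by (rule poly_bezout)
  obtain a c where a: "A = g * a" and c: "C = g * c" using g(2,3) by (elim dvdE)
  have nz: "g \<noteq> 0" "c \<noteq> 0" using assms(2) c by auto
  have "g * (u * a + v * c) = g * 1" using g(1) a c by (simp add: algebra_simps)
  then have "u * a + v * c = 1" using nz(1) by (metis mult_cancel_left)
  then have "coprime a c" by (auto simp: coprime_poly_iff_bezout)
  then have "coprime (a ^ k) (c ^ k)" by (rule coprime_poly_powers)
  moreover have "a ^ k dvd c ^ k" using assms(3) nz(1) by (simp add: a c power_mult_distrib)
  ultimately have "is_unit (a ^ k)" by (simp add: coprime_def)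
  then have "is_unit a" using assms(1) by (simp add: is_unit_power_iff)
  then show ?thesis unfolding a c by (simp add: unit_imp_dvd)
qed

text \<open>Transfers the universal property to any given monic k-th root of \<open>kgcd\<close>:
  two monic polynomials with equal k-th powers divide each other.\<close>

lemma kgcd_root_props:
  fixes A B D :: "'a::field poly"
  assumes "k \<ge> 1" "B \<noteq> 0" "lead_coeff D = 1" "D ^ k = kgcd k A B"
  shows "D ^ k dvd A" "D ^ k dvd B" "\<And>E. E ^ k dvd A \<Longrightarrow> E ^ k dvd B \<Longrightarrow> E dvd D"
proof -
  obtain C where C: "lead_coeff C = 1" "kgcd k A B = C ^ k" "C ^ k dvd A" "C ^ k dvd B"
    "\<And>E. E ^ k dvd A \<Longrightarrow> E ^ k dvd B \<Longrightarrow> E dvd C"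
    using kgcd_props[OF assms(1,2), of A] by blast
  have "D = C"
  proof (rule monic_dvd_antisym)
    have eq: "D ^ k = C ^ k" using assms(4) C(2) by simp
    have "D \<noteq> 0" "C \<noteq> 0" using assms(3) C(1) by auto
    then show "D dvd C" "C dvd D"
      using power_dvd_power_imp_dvd[OF assms(1), of C D] power_dvd_power_imp_dvd[OF assms(1), of D C]
      by (simp_all add: eq)
  qed fact+
  then show "D ^ k dvd A" "D ^ k dvd B" "\<And>E. E ^ k dvd A \<Longrightarrow> E ^ k dvd B \<Longrightarrow> E dvd D"
    using C by auto
qed

text \<open>Makes the condition local at the primes of \<open>H\<close>, ready for
  inclusion-exclusion. The k-th root \<open>C\<close> of the \<open>kgcd\<close> divides
  \<open>H\<close>, so a nonconstant \<open>C\<close> has a prime factor among those of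
  \<open>H\<close>.\<close>

lemma kgcd_eq_1_iff:
  fixes D H :: "'a::field poly"
  assumes "k \<ge> 1" "H \<noteq> 0"
  shows "kgcd k D (H ^ k) = 1 \<longleftrightarrow> (\<forall>P \<in> monic_primes H. \<not> P ^ k dvd D)"
proof -
  obtain C where C: "lead_coeff C = 1" "kgcd k D (H ^ k) = C ^ k" "C ^ k dvd D" "C ^ k dvd H ^ k"
    "\<And>E. E ^ k dvd D \<Longrightarrow> E ^ k dvd H ^ k \<Longrightarrow> E dvd C"
    using kgcd_props[of k "H ^ k" D] assms by auto
  show ?thesis
  proof (intro iffI ballI notI)
    fix P assume 1: "kgcd k D (H ^ k) = 1" and P: "P \<in> monic_primes H" "P ^ k dvd D"
    have "P dvd C" using C(5) P by (auto dest: monic_primesD(3) intro: dvd_power_same)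
    then have "P ^ k dvd 1" using 1 C(2) dvd_power_same by metis
    then have "is_unit P" using assms(1) by (simp add: is_unit_power_iff)
    then show False using irreducible_not_unit[OF monic_primesD(2)[OF P(1)]] by blast
  next
    assume *: "\<forall>P \<in> monic_primes H. \<not> P ^ k dvd D"
    have CH: "C dvd H" using power_dvd_power_imp_dvd[OF assms(1) assms(2) C(4)] .
    have "degree C = 0"
    proof (rule ccontr)
      assume "degree C \<noteq> 0"
      then obtain P where P: "P \<in> monic_primes C" using exists_monic_prime[of C] by auto
      then have "P \<in> monic_primes H" using CH dvd_trans by (auto simp: monic_primes_def)
      moreover have "P ^ k dvd D"
        using dvd_power_same[OF monic_primesD(3)[OF P], of k] C(3) dvd_trans by blast
      ultimately show False using * by blast
    qed
    then have "C = 1" using C(1) by (metis degree_eq_zeroE lead_coeff_pCons(2) one_pCons)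
    then show "kgcd k D (H ^ k) = 1" using C(2) by simp
  qed
qed

section \<open>Character sums and Hoelder's formula\<close>

text \<open>Every complete residue system can thus be exchanged for the canonical one; over a finite
  field it is in particular finite.\<close>

lemma bij_betw_complete_residue_system:
  fixes M :: "'a::field poly"
  assumes "M \<noteq> 0" "complete_residue_system M R"
  shows "bij_betw (\<lambda>D. D mod M) R (polys_below (degree M))"
  unfolding bij_betw_def
proof (intro conjI inj_onI equalityI subsetI)
  fix D D' assume D: "D \<in> R" "D' \<in> R" "D mod M = D' mod M"
  then have "[D = D'] (mod M)" "[D = D] (mod M)" by (simp_all add: cong_def)
  then show "D = D'" using assms(2) D(1,2) unfolding complete_residue_system_def by blast
next
  fix D assume "D \<in> (\<lambda>D. D mod M) ` R"
  then show "D \<in> polys_below (degree M)"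
    using mod_eq_self_iff_polys_below[OF assms(1), of D] by auto
next
  fix B :: "'a poly" assume B: "B \<in> polys_below (degree M)"
  obtain D where D: "D \<in> R" "[B = D] (mod M)"
    using assms(2) unfolding complete_residue_system_def by blast
  then have "B = D mod M"
    using B mod_eq_self_iff_polys_below[OF assms(1), of B] by (simp add: cong_def)
  then show "B \<in> (\<lambda>D. D mod M) ` R" using D(1) by blast
qed

lemma sum_complete_residue_system:
  fixes M :: "'a::field poly" and f :: "'a poly \<Rightarrow> complex"
  assumes "M \<noteq> 0" "complete_residue_system M R" "\<And>D. f (D mod M) = f D"
  shows "sum f R = sum f (polys_below (degree M))"
  using sum.reindex_bij_betw[OF bij_betw_complete_residue_system[OF assms(1,2)], of f] assms(3)
  by simp

section \<open>Additive characters and orthogonality\<close>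

lemma t_coeff_add: "t_coeff M (A + B) = t_coeff M A + t_coeff M B"
  by (simp add: t_coeff_def poly_mod_add_left)

lemma t_coeff_mod: "t_coeff M (A * (B mod M)) = t_coeff M (A * B)"
  by (simp add: t_coeff_def mod_mult_right_eq)

text \<open>The remainder of \<open>T * B\<close> modulo \<open>T * U\<close> is \<open>T\<close>
  times that of \<open>B\<close> modulo \<open>U\<close>, and its coefficient just below
  \<open>degree (T * U)\<close> is the product of the two top coefficients.\<close>

lemma t_coeff_mult_mult:
  fixes T U B :: "'a::field poly"
  assumes "T \<noteq> 0" "U \<noteq> 0"
  shows "t_coeff (T * U) (T * B) = lead_coeff T * t_coeff U B"
proof (cases "degree U = 0")
  \<comment> \<open>For constant \<open>U\<close> the right side is 0 by convention; the left side
    is 0 because \<open>T * U\<close> divides \<open>T * B\<close>.\<close>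
  case True
  then have "is_unit U" using assms(2) by (simp add: is_unit_iff_degree)
  then have "T * B mod (T * U) = 0"
    by (simp add: mod_mult_mult1 unit_imp_mod_eq_0)
  then show ?thesis using True by (auto simp: t_coeff_def)
next
  case False
  define r where "r = B mod U"
  have deg: "degree (T * U) = degree T + degree U" using assms by (rule degree_mult_eq)
  have r: "degree r \<le> degree U - 1"
    using degree_mod_less[OF assms(2), of B] False by (auto simp: r_def)
  have "coeff (T * r) (degree T + (degree U - 1)) = lead_coeff T * coeff r (degree U - 1)"
  proof (cases "degree r = degree U - 1")
    case True
    then show ?thesis using coeff_mult_degree_sum[of T r] by simp
  next
    case False
    then have "degree r < degree U - 1" using r by simp
    then show ?thesis
      using degree_mult_le[of T r] by (simp add: coeff_eq_0)
  qed
  then show ?thesis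
    using False deg by (simp add: t_coeff_def mod_mult_mult1 r_def)
qed

lemma nontrivial_additive_character_0:
  assumes "nontrivial_additive_character lam"
  shows "lam 0 = 1"
proof -
  have "lam 0 \<noteq> 0" "lam (0 + 0) = lam 0 * lam 0"
    using assms unfolding nontrivial_additive_character_def by blast+
  then show ?thesis by simp
qed

text \<open>If \<open>U\<close> does not divide \<open>G\<close>, a suitable translation of the
  residues multiplies the sum by a number other than 1, so the sum vanishes.\<close>

lemma character_sum:
  fixes U G :: "'a::finite_field poly"
  assumes lam: "nontrivial_additive_character lam" and U: "U \<noteq> 0"
  shows "(\<Sum>D \<in> polys_below (degree U). lam (t_coeff U (G * D)))
    = (if U dvd G then of_nat (CARD('a) ^ degree U) else 0)"
proof (cases "U dvd G")
  case True
  then have "t_coeff U (G * D) = 0" for D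
    by (simp add: t_coeff_def mod_eq_0_iff_dvd)
  then show ?thesis
    using True finite_card_polys_below[where 'a='a] nontrivial_additive_character_0[OF lam] by simp
next
  case False
  define r where "r = G mod U"
  have r0: "r \<noteq> 0" using False by (simp add: r_def dvd_eq_mod_eq_0)
  then have r: "degree r < degree U" using degree_mod_less[OF U, of G] by (simp add: r_def)
  obtain c where c: "lam c \<noteq> 1" using lam by (auto simp: nontrivial_additive_character_def)
  \<comment> \<open>\<open>D0\<close> is the monomial that moves the leading term of
    \<open>r\<close> to degree \<open>degree U - 1\<close> with coefficient \<open>c\<close>, so
    that \<open>t_coeff U (G * D0) = c\<close>.\<close>
  define j where "j = degree U - 1 - degree r"
  define D0 where "D0 = monom (c / lead_coeff r) j"
  have j: "j + degree r = degree U - 1" using r by (simp add: j_def)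
  have "degree (D0 * r) \<le> j + degree r"
    using degree_mult_le[of D0 r] degree_monom_le[of "c / lead_coeff r" j] unfolding D0_def by linarith
  then have lt: "degree (D0 * r) < degree U" using j r by simp
  have "G * D0 mod U = (D0 * r) mod U"
    unfolding r_def by (simp add: mod_mult_right_eq mult.commute)
  also have "\<dots> = D0 * r" using lt by (rule mod_poly_less)
  finally have "t_coeff U (G * D0) = coeff (D0 * r) (j + degree r)"
    using r j by (simp add: t_coeff_def)
  also have "\<dots> = c" using r0 by (simp add: D0_def coeff_monom_mult)
  finally have t0: "t_coeff U (G * D0) = c" .
  have D0: "coeff D0 i = 0" if "i \<ge> degree U" for i
    using that j r by (simp add: D0_def)
  let ?f = "\<lambda>D. lam (t_coeff U (G * D))"
  have shift: "?f (D + D0) = ?f D * lam c" for D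
    using lam t0 by (simp add: ring_distribs t_coeff_add nontrivial_additive_character_def)
  have "sum ?f (polys_below (degree U)) = (\<Sum>D \<in> polys_below (degree U). ?f (D + D0))"
    by (rule sum.reindex_bij_witness[of _ "\<lambda>D. D + D0" "\<lambda>D. D - D0"])
       (auto simp: polys_below_def D0)
  also have "\<dots> = sum ?f (polys_below (degree U)) * lam c"
    by (simp only: shift sum_distrib_right)
  finally have "sum ?f (polys_below (degree U)) * (1 - lam c) = 0"
    by (simp add: algebra_simps)
  then show ?thesis using c False by simp
qed

text \<open>Writing \<open>D = T * D'\<close> turns the multiples of \<open>T\<close> modulo
  \<open>T * U\<close> into the residues modulo \<open>U\<close>; as \<open>T\<close> is monic, the
  character is not twisted.\<close>

lemma character_sum_multiples:
  fixes T U G :: "'a::finite_field poly"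
  assumes lam: "nontrivial_additive_character lam" and T: "lead_coeff T = 1" and U: "U \<noteq> 0"
  shows "(\<Sum>D \<in> polys_below (degree (T * U)). of_bool (T dvd D) * E_char lam G (T * U) D)
    = (if U dvd G then of_nat (CARD('a) ^ degree U) else 0)"
proof -
  have T0: "T \<noteq> 0" using T by auto
  have TU: "T * U \<noteq> 0" using T0 U by simp
  have eq: "{D \<in> polys_below (degree (T * U)). T dvd D} = (*) T ` polys_below (degree U)"
  proof (intro equalityI subsetI)
    fix D assume "D \<in> {D \<in> polys_below (degree (T * U)). T dvd D}"
    then have *: "D mod (T * U) = D" "T dvd D" using mod_eq_self_iff_polys_below[OF TU, of D] by auto
    then obtain D' where D': "D = T * D'" by (elim dvdE)
    then have "T * (D' mod U) = T * D'" using *(1) by (simp add: mod_mult_mult1)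
    then have "D' mod U = D'" using T0 by simp
    then show "D \<in> (*) T ` polys_below (degree U)"
      using mod_eq_self_iff_polys_below[OF U, of D'] D' by blast
  next
    fix D assume "D \<in> (*) T ` polys_below (degree U)"
    then obtain D' where D': "D = T * D'" "D' mod U = D'"
      using mod_eq_self_iff_polys_below[OF U] by blast
    then have "D mod (T * U) = D" by (simp add: mod_mult_mult1)
    then show "D \<in> {D \<in> polys_below (degree (T * U)). T dvd D}"
      using mod_eq_self_iff_polys_below[OF TU, of D] D'(1) by simp
  qed
  have "(\<Sum>D \<in> polys_below (degree (T * U)). of_bool (T dvd D) * E_char lam G (T * U) D)
      = (\<Sum>D \<in> {D \<in> polys_below (degree (T * U)). T dvd D}. E_char lam G (T * U) D)"
    using finite_card_polys_below[where 'a='a]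
    by (intro sum.mono_neutral_cong_right) auto
  also have "\<dots> = (\<Sum>D \<in> polys_below (degree U). E_char lam G (T * U) (T * D))"
    unfolding eq using T0 by (subst sum.reindex) (auto simp: inj_on_def)
  also have "\<dots> = (\<Sum>D \<in> polys_below (degree U). lam (t_coeff U (G * D)))"
    using t_coeff_mult_mult[OF T0 U] T by (simp add: E_char_def mult.left_commute[of G T])
  finally show ?thesis using character_sum[OF lam U] by simp
qed


section \<open>Absolute values, the Moebius function and Hoelder's formula\<close>

lemma pabs_pos: "pabs B > 0"
  by (simp add: pabs_def)

lemma pabs_mult:
  assumes "A \<noteq> 0" "B \<noteq> 0" shows "pabs (A * B) = pabs A * pabs B"
  using assms by (simp add: pabs_def degree_mult_eq power_add)

lemma pabs_prod:
  assumes "\<And>x. x \<in> Y \<Longrightarrow> f x \<noteq> 0"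
  shows "pabs (prod f Y) = (\<Prod>x\<in>Y. pabs (f x))"
  using assms
proof (induction Y rule: infinite_finite_induct)
  case (insert x Y)
  then show ?case by (simp add: pabs_mult)
qed (simp_all add: pabs_def)

text \<open>A squarefree \<open>N\<close> and its radical divide each other, so they have equal
  degree even if \<open>N\<close> is not monic.\<close>

lemma pabs_eq_prod_monic_primes:
  fixes N :: "'a::finite_field poly"
  assumes "N \<noteq> 0" "N dvd poly_radical N"
  shows "pabs N = (\<Prod>P \<in> monic_primes N. pabs P)"
proof -
  have "poly_radical N \<noteq> 0" using lead_coeff_poly_radical[of N] by auto
  then have "degree N = degree (poly_radical N)"
    using assms poly_radical_dvd[OF finite_monic_primes[OF assms(1)]]
    by (intro antisym dvd_imp_degree_le) auto
  then have "pabs N = pabs (poly_radical N)" by (simp add: pabs_def)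
  also have "\<dots> = (\<Prod>P \<in> monic_primes N. pabs P)"
    unfolding poly_radical_def by (rule pabs_prod) (rule monic_primesD)
  finally show ?thesis .
qed

lemma phi_eq: "phi k H = pabs H ^ k * (\<Prod>P \<in> monic_primes H. 1 - 1 / pabs P ^ k)"
  by (simp add: phi_def monic_primes_def)

text \<open>Insensitive to unit factors, since the quotient \<open>N\<close> in the theorem need not
  be monic.\<close>

definition moebius :: "'a::field poly \<Rightarrow> complex" where
  "moebius N = (if N dvd poly_radical N then (-1) ^ card (monic_primes N) else 0)"

lemma monic_prime_powers_dvd_iff:
  assumes "finite Y" "Y \<subseteq> monic_primes H"
  shows "(\<forall>P\<in>Y. P ^ k dvd D) \<longleftrightarrow> \<Prod>Y ^ k dvd D"
proof
  assume "\<forall>P\<in>Y. P ^ k dvd D"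
  then have "(\<Prod>P\<in>Y. P ^ k) dvd D"
    using assms coprime_monic_primes
    by (intro prod_coprime_poly_dvd coprime_poly_powers) blast+
  then show "\<Prod>Y ^ k dvd D" by (simp add: prod_power_distrib)
next
  assume *: "\<Prod>Y ^ k dvd D"
  show "\<forall>P\<in>Y. P ^ k dvd D"
  proof
    fix P assume "P \<in> Y"
    then have "P dvd \<Prod>Y" using assms(1) by (rule dvd_prodI[rotated])
    then show "P ^ k dvd D" using * dvd_power_same dvd_trans by blast
  qed
qed

text \<open>Inclusion-exclusion over sets \<open>Y\<close> of primes of \<open>H\<close>. Each
  \<open>Y\<close> contributes a character sum over the multiples of \<open>\<Prod>Y ^ k\<close>,
  and the universal property of \<open>A\<close> decides when it is nonzero.\<close>

lemma eta_eq_subset_sum: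
  fixes lam :: "'a::finite_field \<Rightarrow> complex"
  assumes k: "k \<ge> 1" and lam: "nontrivial_additive_character lam" and H: "H \<noteq> 0"
    and R: "complete_residue_system (H ^ k) R"
    and A: "lead_coeff A = 1" "A ^ k = kgcd k G (H ^ k)" and N: "H = A * N"
  shows "eta lam k R G H = (\<Sum>Y \<in> Pow (monic_primes H).
    (-1) ^ card Y * (if N dvd \<Prod>Y then of_real (pabs H ^ k / (\<Prod>P\<in>Y. pabs P ^ k)) else 0))"
proof -
  let ?M = "H ^ k" and ?P = "monic_primes H"
  let ?E = "E_char lam G ?M"
  let ?S = "polys_below (degree ?M) :: 'a poly set"
  have M0: "?M \<noteq> 0" using H by simp
  have fin: "finite ?P" using H by (rule finite_monic_primes)
  define f where "f = (\<lambda>D. of_bool (kgcd k D ?M = 1) * ?E D)"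
  \<comment> \<open>The summand depends only on \<open>D\<close> modulo \<open>H ^ k\<close>, which
    allows passing from \<open>R\<close> to the canonical residues.\<close>
  have dvd_mod: "P ^ k dvd D mod ?M \<longleftrightarrow> P ^ k dvd D" if "P \<in> ?P" for P D
    using that by (intro dvd_mod_iff dvd_power_same monic_primesD)
  have f_mod: "f (D mod ?M) = f D" for D
    using dvd_mod by (simp add: f_def kgcd_eq_1_iff[OF k H] E_char_def t_coeff_mod)
  have "finite R"
    using bij_betw_finite[OF bij_betw_complete_residue_system[OF M0 R]] finite_card_polys_below
    by blast
  then have "eta lam k R G H = sum f R"
    unfolding eta_def f_def by (intro sum.mono_neutral_cong_left) auto
  also have "\<dots> = sum f ?S" using M0 R f_mod by (rule sum_complete_residue_system)
  also have "\<dots> = (\<Sum>D\<in>?S. \<Sum>Y\<in>Pow ?P. (-1) ^ card Y * (of_bool (\<Prod>Y ^ k dvd D) * ?E D))"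
  proof (rule sum.cong[OF refl])
    fix D
    \<comment> \<open>Expanding this product of indicators over subsets is the
      inclusion-exclusion.\<close>
    have "of_bool (kgcd k D ?M = 1) = (\<Prod>P\<in>?P. 1 - of_bool (P ^ k dvd D) :: complex)"
    proof (cases "kgcd k D ?M = 1")
      case True
      then show ?thesis by (auto simp: kgcd_eq_1_iff[OF k H])
    next
      case False
      then obtain P where "P \<in> ?P" "P ^ k dvd D" by (auto simp: kgcd_eq_1_iff[OF k H])
      then show ?thesis using fin False by (auto simp: prod_zero_iff)
    qed
    also have "\<dots> = (\<Sum>Y\<in>Pow ?P. (-1) ^ card Y * (\<Prod>P\<in>Y. of_bool (P ^ k dvd D)))"
      using prod_diff_conv_sum[OF fin, of "\<lambda>_. 1"] by simp
    also have "\<dots> = (\<Sum>Y\<in>Pow ?P. (-1) ^ card Y * of_bool (\<Prod>Y ^ k dvd D))"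
    proof (rule sum.cong[OF refl])
      fix Y assume "Y \<in> Pow ?P"
      then have Y: "finite Y" "Y \<subseteq> ?P" using fin by (auto intro: finite_subset)
      have "(\<Prod>P\<in>Y. of_bool (P ^ k dvd D)) = (of_bool (\<forall>P\<in>Y. P ^ k dvd D) :: complex)"
        using Y(1) by (induction Y rule: finite_induct) auto
      then show "(-1) ^ card Y * (\<Prod>P\<in>Y. of_bool (P ^ k dvd D))
          = (-1) ^ card Y * (of_bool (\<Prod>Y ^ k dvd D) :: complex)"
        using monic_prime_powers_dvd_iff[OF Y] by simp
    qed
    finally show "f D = (\<Sum>Y\<in>Pow ?P. (-1) ^ card Y * (of_bool (\<Prod>Y ^ k dvd D) * ?E D))"
      unfolding f_def by (simp add: sum_distrib_right mult.assoc)
  qed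
  also have "\<dots> = (\<Sum>Y\<in>Pow ?P. (-1) ^ card Y * (\<Sum>D\<in>?S. of_bool (\<Prod>Y ^ k dvd D) * ?E D))"
    by (subst sum.swap) (simp only: sum_distrib_left)
  also have "\<dots> = (\<Sum>Y\<in>Pow ?P. (-1) ^ card Y *
      (if N dvd \<Prod>Y then of_real (pabs H ^ k / (\<Prod>P\<in>Y. pabs P ^ k)) else 0))"
  proof (rule sum.cong[OF refl])
    fix Y assume "Y \<in> Pow ?P"
    then have Y: "finite Y" "Y \<subseteq> ?P" using fin by (auto intro: finite_subset)
    define T where "T = \<Prod>Y"
    have monicT: "lead_coeff T = 1"
      unfolding T_def lead_coeff_prod using Y by (intro prod.neutral) (auto simp: monic_primes_def)
    have "T dvd H"
      using monic_prime_powers_dvd_iff[OF Y, of 1 H] Y(2) by (auto simp: T_def monic_primes_def)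
    then obtain U where U: "H = T * U" by (elim dvdE)
    have nz: "T \<noteq> 0" "U \<noteq> 0" "A \<noteq> 0" using U H A(1) by auto
    have M: "?M = T ^ k * U ^ k" by (simp add: U power_mult_distrib)
    have "U ^ k dvd ?M" by (simp add: M)
    \<comment> \<open>\<open>U\<close> is the cofactor of \<open>T\<close> and \<open>N\<close> that
      of \<open>A\<close> in \<open>H\<close>, so \<open>U dvd A\<close> and \<open>N dvd T\<close>
      say the same.\<close>
    then have "U ^ k dvd G \<longleftrightarrow> U dvd A"
      using kgcd_root_props[OF k M0 A] dvd_power_same[of U A k] dvd_trans by blast
    also have "\<dots> \<longleftrightarrow> A * N dvd A * T" using U N nz by (metis dvd_times_left_cancel_iff mult.commute)
    also have "\<dots> \<longleftrightarrow> N dvd T" using nz by simp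
    finally have iff: "U ^ k dvd G \<longleftrightarrow> N dvd T" .
    have "real (CARD('a) ^ degree (U ^ k)) = pabs U ^ k"
      using nz by (simp add: pabs_def degree_power_eq mult.commute flip: power_mult)
    also have "\<dots> = pabs H ^ k / pabs T ^ k"
      using nz pabs_pos[of T] by (simp add: U pabs_mult power_mult_distrib)
    also have "pabs T ^ k = (\<Prod>P\<in>Y. pabs P ^ k)"
      unfolding T_def using Y(2)
      by (subst pabs_prod) (auto simp: prod_power_distrib dest: monic_primesD(4))
    finally have val: "of_nat (CARD('a) ^ degree (U ^ k))
        = (of_real (pabs H ^ k / (\<Prod>P\<in>Y. pabs P ^ k)) :: complex)"
      by (metis of_real_of_nat_eq)
    have "(\<Sum>D\<in>?S. of_bool (T ^ k dvd D) * ?E D)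
        = (if U ^ k dvd G then of_nat (CARD('a) ^ degree (U ^ k)) else 0)"
      using character_sum_multiples[OF lam, of "T ^ k" "U ^ k" G] monicT nz
      unfolding M by (simp add: lead_coeff_power)
    then show "(-1) ^ card Y * (\<Sum>D\<in>?S. of_bool (\<Prod>Y ^ k dvd D) * ?E D) = (-1) ^ card Y *
        (if N dvd \<Prod>Y then of_real (pabs H ^ k / (\<Prod>P\<in>Y. pabs P ^ k)) else 0)"
      unfolding iff val T_def by simp
  qed
  finally show ?thesis .
qed

text \<open>Only sets \<open>Y\<close> containing all primes of \<open>N\<close> contribute, and
  only for squarefree \<open>N\<close>. The sum over them is a product over the primes
  \<open>P\<close> of \<open>H\<close>, with factor \<open>- 1 / pabs P ^ k\<close> if
  \<open>P\<close> divides \<open>N\<close> and \<open>1 - 1 / pabs P ^ k\<close> otherwise.\<close>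

lemma eta_hoelder:
  fixes lam :: "'a::finite_field \<Rightarrow> complex"
  assumes "k \<ge> 1" "nontrivial_additive_character lam" and H: "H \<noteq> 0"
    and "complete_residue_system (H ^ k) R"
    and "lead_coeff A = 1" "A ^ k = kgcd k G (H ^ k)" and N: "H = A * N"
  shows "of_real (phi k N) * eta lam k R G H = of_real (phi k H) * moebius N"
proof -
  let ?P = "monic_primes H" and ?Z = "monic_primes N"
  have fin: "finite ?P" using H by (rule finite_monic_primes)
  have N0: "N \<noteq> 0" using H N by auto
  have sub: "?Z \<subseteq> ?P" using N by (auto simp: monic_primes_def)
  have finZ: "finite ?Z" using sub fin by (rule finite_subset)
  define b where "b = (\<lambda>P::'a poly. 1 / pabs P ^ k)"
  have eta: "eta lam k R G H = (\<Sum>Y \<in> Pow ?P. (-1) ^ card Y *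
      (if N dvd \<Prod>Y then of_real (pabs H ^ k / (\<Prod>P\<in>Y. pabs P ^ k)) else 0))"
    using assms by (rule eta_eq_subset_sum)
  have iff: "N dvd \<Prod>Y \<longleftrightarrow> ?Z \<subseteq> Y \<and> N dvd poly_radical N" if "Y \<in> Pow ?P" for Y
    using that fin by (intro dvd_prod_monic_irreducible_iff) (auto intro: finite_subset simp: monic_primes_def)
  show ?thesis
  proof (cases "N dvd poly_radical N")
    case False
    then have "eta lam k R G H = 0" unfolding eta using iff by (intro sum.neutral) auto
    then show ?thesis using False by (simp add: moebius_def)
  next
    case True
    \<comment> \<open>The constraint \<open>?Z \<subseteq> Y\<close> becomes a product of indicators
      over the complement of \<open>Y\<close>; the sum then has the shape of an expanded product of
      differences.\<close>
    have "eta lam k R G H = (\<Sum>Y \<in> Pow ?P. of_real (pabs H ^ k * ((-1) ^ card Y *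
        (\<Prod>P\<in>Y. b P) * (\<Prod>P\<in>?P - Y. of_bool (P \<notin> ?Z)))))"
      unfolding eta
    proof (rule sum.cong[OF refl])
      fix Y assume Y: "Y \<in> Pow ?P"
      have "(\<Prod>P\<in>?P - Y. of_bool (P \<notin> ?Z)) = (of_bool (?Z \<subseteq> Y) :: real)"
      proof (cases "?Z \<subseteq> Y")
        case False
        then obtain P where "P \<in> ?P - Y" "P \<in> ?Z" using sub by blast
        then show ?thesis using False fin by (auto simp: prod_zero_iff)
      qed (auto intro!: prod.neutral)
      moreover have "(\<Prod>P\<in>Y. b P) = 1 / (\<Prod>P\<in>Y. pabs P ^ k)"
        unfolding b_def by (simp add: prod_dividef)
      ultimately show "(-1) ^ card Y *
          (if N dvd \<Prod>Y then of_real (pabs H ^ k / (\<Prod>P\<in>Y. pabs P ^ k)) else 0)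
        = (of_real (pabs H ^ k * ((-1) ^ card Y * (\<Prod>P\<in>Y. b P) *
            (\<Prod>P\<in>?P - Y. of_bool (P \<notin> ?Z)))) :: complex)"
        using iff[OF Y] True by simp
    qed
    also have "\<dots> = of_real (pabs H ^ k * (\<Prod>P\<in>?P. of_bool (P \<notin> ?Z) - b P))"
      unfolding prod_diff_conv_sum[OF fin] by (simp only: sum_distrib_left of_real_sum)
    also have "(\<Prod>P\<in>?P. of_bool (P \<notin> ?Z) - b P)
        = (\<Prod>P\<in>?P - ?Z. of_bool (P \<notin> ?Z) - b P) * (\<Prod>P\<in>?Z. of_bool (P \<notin> ?Z) - b P)"
      using sub fin by (rule prod.subset_diff)
    also have "(\<Prod>P\<in>?Z. of_bool (P \<notin> ?Z) - b P) = (\<Prod>P\<in>?Z. (-1) * b P)"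
      by (intro prod.cong) auto
    \<comment> \<open>As \<open>N\<close> is squarefree, the absolute values of its primes multiply
      to \<open>pabs N\<close>.\<close>
    also have "\<dots> = (-1) ^ card ?Z / pabs N ^ k"
      unfolding prod.distrib pabs_eq_prod_monic_primes[OF N0 True]
      by (simp add: b_def prod_dividef prod_power_distrib)
    also have "(\<Prod>P\<in>?P - ?Z. of_bool (P \<notin> ?Z) - b P) = (\<Prod>P\<in>?P - ?Z. 1 - b P)"
      by (intro prod.cong) auto
    finally have eta': "eta lam k R G H
        = of_real (pabs H ^ k * ((\<Prod>P\<in>?P - ?Z. 1 - b P) * ((-1) ^ card ?Z / pabs N ^ k)))" .
    have "phi k H = pabs H ^ k * ((\<Prod>P\<in>?P - ?Z. 1 - b P) * (\<Prod>P\<in>?Z. 1 - b P))"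
      unfolding phi_eq b_def using prod.subset_diff[OF sub fin] by metis
    moreover have "phi k N = pabs N ^ k * (\<Prod>P\<in>?Z. 1 - b P)" unfolding phi_eq b_def ..
    ultimately have "phi k N * (pabs H ^ k * ((\<Prod>P\<in>?P - ?Z. 1 - b P) * ((-1) ^ card ?Z / pabs N ^ k)))
        = phi k H * (-1) ^ card ?Z"
      using pabs_pos[of N] by (simp add: field_simps)
    then have "complex_of_real (phi k N * (pabs H ^ k * ((\<Prod>P\<in>?P - ?Z. 1 - b P) *
        ((-1) ^ card ?Z / pabs N ^ k)))) = of_real (phi k H * (-1) ^ card ?Z)"
      by (rule arg_cong)
    then show ?thesis
      unfolding eta' using True by (simp add: moebius_def)
  qed
qed

text \<open>Needed to divide Hoelder's formula by \<open>phi k H\<close>.\<close>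

lemma phi_pos:
  fixes H :: "'a::finite_field poly"
  assumes "k \<ge> 1"
  shows "phi k H > 0"
proof -
  have "1 - 1 / pabs P ^ k > 0" if P: "P \<in> monic_primes H" for P :: "'a poly"
  proof -
    have "CARD('a) > 1" using card_mono[of UNIV "{0, 1::'a}"] by simp
    moreover have "degree P * k > 0"
      using degree_irreducible_pos[OF monic_primesD(2)[OF P]] assms by simp
    ultimately have "pabs P ^ k > 1"
      unfolding pabs_def power_mult[symmetric] by (intro one_less_power) auto
    then show ?thesis by simp
  qed
  then have "(\<Prod>P\<in>monic_primes H. 1 - 1 / pabs P ^ k) > 0" by (rule prod_pos)
  then show ?thesis unfolding phi_eq using pabs_pos[of H] by simp
qed

section \<open>Frobenius and degrees of irreducible polynomials\<close>

text \<open>Splitting off one prime at a time, a property that passes from products to factors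
  reaches a prime. It is applied to divisibility by a prime of a larger field and to having a given
  root.\<close>

lemma exists_monic_prime_of_property:
  fixes N :: "'a::field poly"
  assumes "N \<noteq> 0" "C N" "\<And>a b. C (a * b) \<Longrightarrow> C a \<or> C b" "\<And>u. is_unit u \<Longrightarrow> \<not> C u"
  obtains P where "P \<in> monic_primes N" "C P"
proof -
  have "\<exists>P \<in> monic_primes N. C P"
    using assms(1,2)
  proof (induction "degree N" arbitrary: N rule: less_induct)
    case less
    have "degree N > 0" using assms(4)[of N] less.prems by (auto simp: is_unit_iff_degree)
    then obtain P where P: "P \<in> monic_primes N" using exists_monic_prime by blast
    then obtain N' where N': "N = P * N'" using monic_primesD(3)[OF P] by (elim dvdE)
    have nz: "P \<noteq> 0" "N' \<noteq> 0" using less.prems(1) N' by auto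
    show ?case
    proof (cases "C P")
      case False
      then have "C N'" using assms(3)[of P N'] less.prems(2) N' by simp
      moreover have "degree N' < degree N"
        using degree_irreducible_pos[OF monic_primesD(2)[OF P]] nz by (simp add: N' degree_mult_eq)
      ultimately obtain R where "R \<in> monic_primes N'" "C R" using less.hyps nz by blast
      then show ?thesis using N' by (auto simp: monic_primes_def)
    qed (use P in blast)
  qed
  then show ?thesis using that by blast
qed

text \<open>Besides \<open>\<iota>\<close>, it is instantiated with powers of Frobenius and with
  embeddings into an algebraic closure.\<close>

locale field_hom =
  fixes \<iota> :: "'a::field \<Rightarrow> 'b::field"
  assumes embedding: "field_embedding \<iota>"
begin

lemma hom_1 [simp]: "\<iota> 1 = 1"
  and hom_add [simp]: "\<iota> (x + y) = \<iota> x + \<iota> y"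
  and hom_mult [simp]: "\<iota> (x * y) = \<iota> x * \<iota> y"
  using embedding unfolding field_embedding_def by blast+

lemma hom_0 [simp]: "\<iota> 0 = 0"
  using hom_add[of 0 0] by (metis add_cancel_left_left add_0)

lemma hom_minus [simp]: "\<iota> (- x) = - \<iota> x"
  using hom_add[of x "- x"] by (simp del: hom_add add: eq_neg_iff_add_eq_0 add.commute)

lemma hom_diff [simp]: "\<iota> (x - y) = \<iota> x - \<iota> y"
  using hom_add[of x "- y"] by (simp del: hom_add)

lemma hom_power [simp]: "\<iota> (x ^ n) = \<iota> x ^ n"
  by (induction n) simp_all

lemma hom_sum: "\<iota> (sum f Y) = (\<Sum>x\<in>Y. \<iota> (f x))"
  by (induction Y rule: infinite_finite_induct) simp_all

lemma hom_eq_0_iff [simp]: "\<iota> x = 0 \<longleftrightarrow> x = 0"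
proof
  assume 0: "\<iota> x = 0"
  show "x = 0"
  proof (rule ccontr)
    assume "x \<noteq> 0"
    then have "\<iota> x * \<iota> (inverse x) = 1" by (simp flip: hom_mult)
    then show False using 0 by simp
  qed
qed simp

lemma hom_eq_iff [simp]: "\<iota> x = \<iota> y \<longleftrightarrow> x = y"
  using hom_eq_0_iff[of "x - y"] by (simp del: hom_eq_0_iff)

lemma hom_inj: "inj \<iota>"
  by (auto simp: inj_on_def)

abbreviation lift :: "'a poly \<Rightarrow> 'b poly" where "lift \<equiv> map_poly \<iota>"

lemma coeff_lift [simp]: "coeff (lift p) i = \<iota> (coeff p i)"
  by (simp add: coeff_map_poly)

lemma degree_lift [simp]: "degree (lift p) = degree p"
  by (intro degree_map_poly) simp

lemma lift_pCons [simp]: "lift (pCons a p) = pCons (\<iota> a) (lift p)"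
  by (simp add: map_poly_pCons)

lemma lift_add [simp]: "lift (p + r) = lift p + lift r"
  by (simp add: poly_eq_iff)

lemma lift_smult [simp]: "lift (smult c p) = smult (\<iota> c) (lift p)"
  by (simp add: poly_eq_iff)

lemma lift_mult [simp]: "lift (p * r) = lift p * lift r"
  by (induction p) simp_all

lemma lift_power [simp]: "lift (p ^ k) = lift p ^ k"
  by (induction k) simp_all

lemma lift_prod: "lift (prod f Y) = (\<Prod>x\<in>Y. lift (f x))"
  by (induction Y rule: infinite_finite_induct) simp_all

lemma lift_eq_iff [simp]: "lift p = lift r \<longleftrightarrow> p = r"
  by (auto simp: poly_eq_iff)

lemma lift_eq_0_iff [simp]: "lift p = 0 \<longleftrightarrow> p = 0"
  using lift_eq_iff[of p 0] by (simp del: lift_eq_iff)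

lemma poly_lift: "poly (lift p) (\<iota> x) = \<iota> (poly p x)"
  by (induction p) simp_all

text \<open>The image of a remainder still satisfies the degree bound, so division with remainder
  does not change under the embedding. Hence divisibility is reflected as well.\<close>

lemma lift_mod: "lift (p mod r) = lift p mod lift r"
proof (cases "r = 0")
  case False
  have "lift p = lift (p div r) * lift r + lift (p mod r)"
    by (simp flip: lift_mult lift_add)
  then have "lift p mod lift r = lift (p mod r) mod lift r" by simp
  also have "\<dots> = lift (p mod r)"
    using degree_mod_less[OF False, of p] by (auto intro: mod_poly_less)
  finally show ?thesis ..
qed simp

lemma lift_dvd_iff [simp]: "lift p dvd lift r \<longleftrightarrow> p dvd r"
  by (simp add: dvd_eq_mod_eq_0 flip: lift_mod)

lemma t_coeff_lift: "t_coeff (lift M) (lift B) = \<iota> (t_coeff M B)"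
  by (simp add: t_coeff_def flip: lift_mod)

lemma coprime_lift:
  assumes "coprime p r" shows "coprime (lift p) (lift r)"
proof -
  obtain u v where "u * p + v * r = 1" using assms by (auto simp: coprime_poly_iff_bezout)
  then have "lift u * lift p + lift v * lift r = 1" by (simp flip: lift_mult lift_add)
  then show ?thesis by (auto simp: coprime_poly_iff_bezout)
qed

text \<open>Each prime over the larger field lies above some prime over the smaller one; with the
  disjointness below, this partitions the primes of \<open>lift N\<close>.\<close>

lemma monic_primes_lift:
  assumes "N \<noteq> 0"
  shows "monic_primes (lift N) = (\<Union>P \<in> monic_primes N. monic_primes (lift P))"
proof (intro equalityI subsetI)
  fix Q assume Q: "Q \<in> monic_primes (lift N)"
  have "prime_elem Q" using monic_primesD(2)[OF Q] by (rule field_poly_irreducible_imp_prime)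
  then have 1: "Q dvd lift a \<or> Q dvd lift b" if "Q dvd lift (a * b)" for a b
    using that prime_elem_dvd_mult_iff[of Q "lift a" "lift b"] by simp
  have 2: "\<not> Q dvd lift u" if "is_unit u" for u
  proof
    assume "Q dvd lift u"
    moreover have "is_unit (lift u)" using that lift_dvd_iff[of u 1] by simp
    ultimately show False
      using irreducible_not_unit[OF monic_primesD(2)[OF Q]] dvd_trans by blast
  qed
  obtain P where "P \<in> monic_primes N" "Q dvd lift P"
    using exists_monic_prime_of_property[of N "\<lambda>p. Q dvd lift p", OF assms monic_primesD(3)[OF Q] 1 2]
    by blast
  then show "Q \<in> (\<Union>P \<in> monic_primes N. monic_primes (lift P))"
    using Q by (auto simp: monic_primes_def)
next
  fix Q assume "Q \<in> (\<Union>P \<in> monic_primes N. monic_primes (lift P))"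
  then obtain P where P: "P \<in> monic_primes N" "Q \<in> monic_primes (lift P)" by blast
  then have "lift P dvd lift N" by (simp add: monic_primes_def)
  then show "Q \<in> monic_primes (lift N)"
    using P(2) dvd_trans unfolding monic_primes_def by blast
qed

lemma disjoint_monic_primes_lift:
  assumes "P \<in> monic_primes N" "P' \<in> monic_primes N" "P \<noteq> P'"
  shows "monic_primes (lift P) \<inter> monic_primes (lift P') = {}"
proof -
  have "coprime (lift P) (lift P')" using assms by (intro coprime_lift coprime_monic_primes)
  then show ?thesis
    using irreducible_not_unit by (auto simp: monic_primes_def coprime_def)
qed

end

section \<open>The Frobenius map over a finite base field\<close>

lemma card_ge_2: "CARD('a::finite_field) \<ge> 2"
  using card_mono[of UNIV "{0, 1::'a}"] by simp

text \<open>The target may be infinite, to admit algebraic closures; \<open>q\<close> is a parameter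
  so that the extension field can itself serve as base, with \<open>q ^ n\<close>.\<close>

locale finite_field_hom = field_hom \<iota> for \<iota> :: "'a::finite_field \<Rightarrow> 'b::field" +
  fixes q :: nat
  assumes q_eq: "q = CARD('a)"
begin

lemma q_ge_2: "q \<ge> 2"
  unfolding q_eq by (rule card_ge_2)

text \<open>Additivity of \<open>z \<mapsto> z ^ q\<close> holds because \<open>(x + 1) ^ q - x ^ q - 1\<close> has degree
  less than \<open>q\<close> and vanishes on all of \<open>\<F>\<^sub>q\<close>.\<close>

lemma frobenius_add: "(x + y) ^ q = x ^ q + (y :: 'b) ^ q"
proof -
  note q = q_ge_2
  define f :: "'a poly" where "f = [:1, 1:] ^ q - (monom 1 q + 1)"
  have "f = 0"
  proof (rule ccontr)
    assume "f \<noteq> 0"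
    have "lead_coeff ([:1, 1:] ^ q :: 'a poly) = 1" by (subst lead_coeff_power) simp
    moreover have "degree ([:1, 1:] ^ q :: 'a poly) = q" by (simp add: degree_power_eq)
    ultimately have lin: "degree ([:1, 1:] ^ q :: 'a poly) = q" "coeff ([:1, 1:] ^ q :: 'a poly) q = 1"
      by simp_all
    have "coeff f i = 0" if "i \<ge> q" for i
    proof (cases "i = q")
      case True
      then show ?thesis using lin q by (simp add: f_def)
    next
      case False
      then show ?thesis using that lin q by (simp add: f_def coeff_eq_0)
    qed
    then have "degree f < q"
      using \<open>f \<noteq> 0\<close> by (metis leading_coeff_0_iff not_le)
    moreover have "poly f x = 0" for x
      by (simp add: f_def poly_monom finite_field_power_card_eq_same q_eq)
    then have "{x. poly f x = 0} = UNIV" by simp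
    ultimately show False using card_poly_roots_bound[OF \<open>f \<noteq> 0\<close>] by (simp add: q_eq)
  qed
  \<comment> \<open>An identity of polynomials carries over to \<open>'b\<close> and can be
    evaluated there, in particular at \<open>x / y\<close>.\<close>
  then have "lift ([:1, 1:] ^ q) = lift (monom 1 q + 1)" by (simp add: f_def)
  then have eq: "[:1, 1:] ^ q = monom 1 q + (1 :: 'b poly)" by (simp add: map_poly_monom)
  have *: "(1 + z) ^ q = z ^ q + 1" for z :: 'b
    using arg_cong[OF eq, of "\<lambda>f. poly f z"] by (simp add: poly_monom)
  show ?thesis
  proof (cases "y = 0")
    case False
    then have "x + y = y * (1 + x / y)" by (simp add: ring_distribs add.commute)
    then have "(x + y) ^ q = (y * (1 + x / y)) ^ q" by (rule arg_cong)
    also have "\<dots> = y ^ q * ((x / y) ^ q + 1)" by (simp add: power_mult_distrib *)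
    also have "\<dots> = x ^ q + y ^ q" using False by (simp add: ring_distribs power_divide)
    finally show ?thesis .
  qed (use q in simp)
qed

lemma frobenius_embedding: "field_embedding (\<lambda>z::'b. z ^ (q ^ i))"
proof (induction i)
  case (Suc i)
  then interpret F: field_hom "\<lambda>z::'b. z ^ (q ^ i)" by unfold_locales
  have "(x + y) ^ (q ^ Suc i) = x ^ (q ^ Suc i) + y ^ (q ^ Suc i)" for x y :: 'b
    using F.hom_add[of x y] frobenius_add by (simp add: power_mult mult.commute[of q])
  then show ?case by (simp add: field_embedding_def power_mult_distrib)
qed (simp add: field_embedding_def)

lemma hom_power_q_power: "\<iota> a ^ (q ^ i) = \<iota> a"
  using finite_field_power_card_power_eq_same[OF refl, of a i] by (simp add: q_eq flip: hom_power)

text \<open>The polynomial \<open>X ^ q - X\<close> has at most \<open>q\<close> roots, and the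
  image of \<open>\<iota>\<close> already supplies \<open>q\<close> of them.\<close>

lemma frobenius_fixed_iff: "z ^ q = z \<longleftrightarrow> z \<in> range \<iota>"
proof -
  define f :: "'b poly" where "f = monom 1 q - monom 1 1"
  note q = q_ge_2
  then have "coeff f 1 = -1" by (simp add: f_def)
  then have f0: "f \<noteq> 0" by auto
  have "degree f \<le> q"
    unfolding f_def using q by (intro degree_diff_le degree_monom_le[THEN order_trans]) auto
  then have "card {z. poly f z = 0} \<le> q" using card_poly_roots_bound[OF f0] by simp
  moreover have roots: "{z. poly f z = 0} = {z::'b. z ^ q = z}" by (simp add: f_def poly_monom)
  moreover have "range \<iota> \<subseteq> {z::'b. z ^ q = z}" using hom_power_q_power[of _ 1] by auto
  moreover have "card (range \<iota>) = q" unfolding q_eq using hom_inj by (rule card_image)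
  moreover have "finite {z::'b. z ^ q = z}" using poly_roots_finite[OF f0] roots by simp
  ultimately have "range \<iota> = {z. z ^ q = z}"
    by (metis card_seteq)
  then show ?thesis by auto
qed

text \<open>Galois descent, coefficient by coefficient.\<close>

lemma lift_exists:
  assumes "map_poly (\<lambda>z. z ^ q) D = D"
  obtains T where "D = lift T"
proof -
  have q: "q > 0" using q_ge_2 by simp
  have "coeff D i \<in> range \<iota>" for i
  proof -
    have "coeff (map_poly (\<lambda>z. z ^ q) D) i = coeff D i ^ q"
      using q by (intro coeff_map_poly) (simp add: power_0_left)
    then show ?thesis using assms frobenius_fixed_iff[of "coeff D i"] by simp
  qed
  then have "D = lift (map_poly (inv_into UNIV \<iota>) D)"
    using inv_f_f[OF hom_inj, of 0] by (auto simp: poly_eq_iff coeff_map_poly f_inv_into_f)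
  then show ?thesis using that by blast
qed

lemma lift_power_q_power: "map_poly (\<lambda>z. z ^ (q ^ i)) (lift D) = lift D"
proof -
  interpret F: field_hom "\<lambda>z::'b. z ^ (q ^ i)" by unfold_locales (rule frobenius_embedding)
  show ?thesis by (simp add: poly_eq_iff hom_power_q_power)
qed

lemma root_power_q_power:
  assumes "poly (lift P) z = 0" shows "poly (lift P) (z ^ (q ^ i)) = 0"
proof -
  interpret F: field_hom "\<lambda>z::'b. z ^ (q ^ i)" by unfold_locales (rule frobenius_embedding)
  have "poly (F.lift (lift P)) (z ^ (q ^ i)) = 0"
    unfolding F.poly_lift assms by (rule F.hom_0)
  then show ?thesis by (simp only: lift_power_q_power)
qed

lemma power_q_power_eqD:
  assumes "(z::'b) ^ (q ^ i) = w ^ (q ^ i)" shows "z = w"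
proof -
  interpret F: field_hom "\<lambda>z::'b. z ^ (q ^ i)" by unfold_locales (rule frobenius_embedding)
  show ?thesis using assms by (simp only: F.hom_eq_iff)
qed

lemma power_q_power_eq_iff:
  assumes "i \<le> j"
  shows "(z::'b) ^ (q ^ i) = z ^ (q ^ j) \<longleftrightarrow> z ^ (q ^ (j - i)) = z"
proof -
  have "z ^ (q ^ j) = (z ^ (q ^ (j - i))) ^ (q ^ i)"
    using assms by (simp flip: power_mult power_add)
  then show ?thesis using power_q_power_eqD[of z i "z ^ (q ^ (j - i))"] by auto
qed

text \<open>Let \<open>m\<close> be the Frobenius period of \<open>\<alpha>\<close>. The
  \<open>m\<close> distinct conjugates are roots of \<open>P\<close>, so
  \<open>m \<le> degree P\<close>; conversely the product of their linear factors descends to the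
  base field and is a multiple of \<open>P\<close>.\<close>

lemma frobenius_period:
  assumes P: "lead_coeff P = 1" "irreducible P" and \<alpha>: "poly (lift P) \<alpha> = 0"
  shows "\<alpha> ^ (q ^ j) = \<alpha> \<longleftrightarrow> degree P dvd j"
proof -
  have P0: "P \<noteq> 0" using P(1) by auto
  have fin: "finite {z. poly (lift P) z = 0}" using P0 by (intro poly_roots_finite) simp
  have roots: "\<alpha> ^ (q ^ i) \<in> {z. poly (lift P) z = 0}" for i
    using root_power_q_power[OF \<alpha>] by simp
  \<comment> \<open>All iterates are roots of \<open>lift P\<close>, so two of them coincide and a
    positive period exists.\<close>
  have "\<not> inj (\<lambda>i. \<alpha> ^ (q ^ i))"
    using fin roots finite_imageD[of "\<lambda>i. \<alpha> ^ (q ^ i)" UNIV]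
    by (metis finite_subset image_subsetI infinite_UNIV_nat)
  then obtain i j where "i < j" "\<alpha> ^ (q ^ i) = \<alpha> ^ (q ^ j)"
    by (metis injI linorder_neqE_nat)
  then have ex: "j - i > 0 \<and> \<alpha> ^ (q ^ (j - i)) = \<alpha>" using power_q_power_eq_iff[of i j \<alpha>] by simp
  define m where "m = (LEAST m. m > 0 \<and> \<alpha> ^ (q ^ m) = \<alpha>)"
  have m: "m > 0" "\<alpha> ^ (q ^ m) = \<alpha>" 
    using LeastI[of "\<lambda>m. m > 0 \<and> \<alpha> ^ (q ^ m) = \<alpha>" "j - i"] ex by (simp_all add: m_def)
  have least: "\<alpha> ^ (q ^ r) \<noteq> \<alpha>" if "0 < r" "r < m" for r
    using not_less_Least[of r "\<lambda>m. m > 0 \<and> \<alpha> ^ (q ^ m) = \<alpha>"] that by (auto simp: m_def)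
  have mult: "\<alpha> ^ (q ^ (m * s)) = \<alpha>" for s
    by (induction s) (simp_all add: power_add power_mult m(2))
  have period: "\<alpha> ^ (q ^ i) = \<alpha> \<longleftrightarrow> m dvd i" for i
  proof -
    have "\<alpha> ^ (q ^ i) = (\<alpha> ^ (q ^ (m * (i div m)))) ^ (q ^ (i mod m))"
      by (simp flip: power_mult power_add)
    then have "\<alpha> ^ (q ^ i) = \<alpha> ^ (q ^ (i mod m))" by (simp only: mult)
    then show ?thesis
      using least[of "i mod m"] m(1) by (cases "i mod m = 0") (auto simp: dvd_eq_mod_eq_0)
  qed
  have inj: "inj_on (\<lambda>i. \<alpha> ^ (q ^ i)) {..<m}"
  proof (rule linorder_inj_onI)
    fix i j assume "i < j" "i \<in> {..<m}" "j \<in> {..<m}"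
    then show "\<alpha> ^ (q ^ i) \<noteq> \<alpha> ^ (q ^ j)"
      using power_q_power_eq_iff[of i j \<alpha>] least[of "j - i"] by auto
  qed auto
  have "m = card ((\<lambda>i. \<alpha> ^ (q ^ i)) ` {..<m})" using inj by (simp add: card_image)
  also have "\<dots> \<le> card {z. poly (lift P) z = 0}" using fin roots by (intro card_mono) auto
  also have "\<dots> \<le> degree P" using card_poly_roots_bound[of "lift P"] P0 by simp
  finally have le: "m \<le> degree P" .
  define P1 where "P1 = (\<Prod>i<m. [:- (\<alpha> ^ (q ^ i)), 1:])"
  interpret F: field_hom "\<lambda>z::'b. z ^ q"
    using frobenius_embedding[of 1] by unfold_locales simp
  have "F.lift P1 = (\<Prod>i<m. [:- (\<alpha> ^ (q ^ Suc i)), 1:])"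
    unfolding P1_def F.lift_prod F.lift_pCons F.hom_minus F.hom_1 map_poly_0
    by (simp add: mult.commute flip: power_mult)
  also have "\<dots> = P1"
  \<comment> \<open>Frobenius permutes the factors cyclically: the last one returns to the first by
    \<open>\<alpha> ^ (q ^ m) = \<alpha>\<close>.\<close>
  proof -
    obtain m' where m': "m = Suc m'" using m(1) by (cases m) auto
    have "(\<Prod>i<m. [:- (\<alpha> ^ (q ^ Suc i)), 1:])
        = (\<Prod>i<m'. [:- (\<alpha> ^ (q ^ Suc i)), 1:]) * [:- (\<alpha> ^ (q ^ m)), 1:]"
      by (simp add: m')
    also have "\<dots> = [:- (\<alpha> ^ (q ^ 0)), 1:] * (\<Prod>i<m'. [:- (\<alpha> ^ (q ^ Suc i)), 1:])"
      by (simp only: m(2) power_0 power_one_right mult.commute)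
    also have "\<dots> = P1" unfolding P1_def m' by (rule prod.lessThan_Suc_shift[symmetric])
    finally show ?thesis .
  qed
  finally obtain T where T: "P1 = lift T" using lift_exists[of P1] by auto
  have "poly P1 \<alpha> = 0"
    unfolding P1_def poly_prod using m(1) by (intro prod_zero bexI[of _ 0]) auto
  \<comment> \<open>Otherwise a Bezout identity for \<open>P\<close> and \<open>T\<close>, evaluated
    at the common root \<open>\<alpha>\<close>, would give 0 = 1.\<close>
  have "P dvd T"
  proof (rule ccontr)
    assume "\<not> P dvd T"
    then have "coprime (lift P) (lift T)"
      using P(2) by (intro coprime_lift irreducible_poly_coprime)
    then obtain u v where "u * lift P + v * lift T = 1" by (auto simp: coprime_poly_iff_bezout)
    then have "poly (u * lift P + v * lift T) \<alpha> = 1" by simp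
    then show False using \<alpha> \<open>poly P1 \<alpha> = 0\<close> T by simp
  qed
  moreover have "degree T = m"
  proof -
    have "degree P1 = m" unfolding P1_def by (subst degree_prod_eq_sum_degree) auto
    then show ?thesis using T by simp
  qed
  moreover have "T \<noteq> 0" using \<open>degree T = m\<close> m(1) by auto
  ultimately have "degree P \<le> m" using dvd_imp_degree_le by blast
  then show ?thesis using le period by simp
qed

text \<open>Separability: the first \<open>degree P\<close> conjugates of one root are
  distinct.\<close>

lemma card_roots_irreducible:
  assumes P: "lead_coeff P = 1" "irreducible P" and \<alpha>: "poly (lift P) \<alpha> = 0"
  shows "card {z. poly (lift P) z = 0} \<ge> degree P"
proof -
  have "P \<noteq> 0" using P(1) by auto
  then have fin: "finite {z. poly (lift P) z = 0}" by (intro poly_roots_finite) simp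
  have "inj_on (\<lambda>i. \<alpha> ^ (q ^ i)) {..<degree P}"
  proof (rule linorder_inj_onI)
    fix i j assume ij: "i < j" "i \<in> {..<degree P}" "j \<in> {..<degree P}"
    then have "\<not> degree P dvd j - i" by (auto dest: dvd_imp_le)
    then show "\<alpha> ^ (q ^ i) \<noteq> \<alpha> ^ (q ^ j)"
      using power_q_power_eq_iff[of i j \<alpha>] frobenius_period[OF assms] ij by auto
  qed auto
  then have "degree P = card ((\<lambda>i. \<alpha> ^ (q ^ i)) ` {..<degree P})" by (simp add: card_image)
  also have "\<dots> \<le> card {z. poly (lift P) z = 0}"
    using fin root_power_q_power[OF \<alpha>] by (intro card_mono) auto
  finally show ?thesis .
qed

end

section \<open>Change of the base field\<close>

lemma field_embedding_to_ac: "field_embedding to_ac"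
  by (simp add: field_embedding_def)

lemma alg_closure_root:
  fixes Q :: "'b::field poly"
  assumes "degree Q > 0"
  obtains \<alpha> where "poly (map_poly to_ac Q) \<alpha> = 0"
proof -
  interpret K: field_hom "to_ac :: 'b \<Rightarrow> 'b alg_closure"
    by unfold_locales (rule field_embedding_to_ac)
  show ?thesis using alg_closed_imp_poly_has_root[of "K.lift Q"] assms that by auto
qed

locale finite_field_ext = finite_field_hom \<iota> q
  for \<iota> :: "'a::finite_field \<Rightarrow> 'b::finite_field" and q +
  fixes n :: nat
  assumes n: "n \<ge> 1" and card_ext: "CARD('b) = q ^ n"
begin

lemma field_embedding_to_ac_comp: "field_embedding (\<lambda>x. to_ac (\<iota> x))"
  by (simp add: field_embedding_def)

text \<open>An irreducible polynomial stays squarefree over the extension: its radical there has the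
  same roots in the algebraic closure, of which there are at least \<open>degree P\<close>.\<close>

lemma poly_radical_lift_prime:
  assumes "lead_coeff P = 1" "irreducible P"
  shows "poly_radical (lift P) = lift P"
proof -
  interpret K: field_hom "to_ac :: 'b \<Rightarrow> 'b alg_closure"
    by unfold_locales (rule field_embedding_to_ac)
  interpret L: finite_field_hom "\<lambda>x. to_ac (\<iota> x) :: 'b alg_closure" q
    by unfold_locales (rule field_embedding_to_ac_comp, rule q_eq)
  have P0: "P \<noteq> 0" using assms(1) by auto
  have KL: "K.lift (lift P) = L.lift P" by (simp add: map_poly_map_poly o_def)
  obtain \<alpha> where \<alpha>: "poly (L.lift P) \<alpha> = 0"
    using alg_closure_root[of "lift P"] degree_irreducible_pos[OF assms(2)] KL by auto
  let ?R = "K.lift (poly_radical (lift P))"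
  have fin: "finite (monic_primes (lift P))" using P0 by (intro finite_monic_primes) simp
  have "poly_radical (lift P) \<noteq> 0" using lead_coeff_poly_radical[of "lift P"] by auto
  then have R0: "?R \<noteq> 0" by simp
  \<comment> \<open>A root of \<open>lift P\<close> is a root of one of its prime factors over
    \<open>'b\<close>, hence of their product.\<close>
  have "poly ?R z = 0" if z: "poly (L.lift P) z = 0" for z
  proof -
    have 1: "poly (K.lift a) z = 0 \<or> poly (K.lift b) z = 0" if "poly (K.lift (a * b)) z = 0" for a b
      using that by simp
    have 2: "poly (K.lift u) z \<noteq> 0" if "is_unit u" for u
      using that by (auto simp: is_unit_poly_iff)
    have "lift P \<noteq> 0" "poly (K.lift (lift P)) z = 0" using P0 z KL by simp_all
    then obtain Q where "Q \<in> monic_primes (lift P)" "poly (K.lift Q) z = 0"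
      using exists_monic_prime_of_property[of "lift P" "\<lambda>p. poly (K.lift p) z = 0"] 1 2 by blast
    then show ?thesis
      unfolding poly_radical_def K.lift_prod poly_prod using fin by (intro prod_zero) auto
  qed
  then have "card {z. poly (L.lift P) z = 0} \<le> card {z. poly ?R z = 0}"
    using poly_roots_finite[OF R0] by (intro card_mono) auto
  also have "\<dots> \<le> degree (poly_radical (lift P))" using card_poly_roots_bound[OF R0] by simp
  finally have "degree P \<le> degree (poly_radical (lift P))"
    using L.card_roots_irreducible[OF assms \<alpha>] by simp
  moreover have "poly_radical (lift P) dvd lift P" using fin by (rule poly_radical_dvd)
  ultimately show ?thesis
    using assms(1) lead_coeff_poly_radical by (intro monic_dvd_degree_imp_eq) auto
qed

text \<open>A root of \<open>Q\<close> is also a root of \<open>P\<close>, and its periods under the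
  Frobenius maps of \<open>'b\<close> and \<open>'a\<close> are the two degrees. Since the former
  map is the n-fold iterate of the latter, the degrees determine each other.\<close>

lemma degree_prime_factor_lift:
  assumes "lead_coeff P = 1" "irreducible P" "Q \<in> monic_primes (lift P)"
  shows "degree P = degree Q * gcd n (degree P)"
proof -
  interpret K: finite_field_hom "to_ac :: 'b \<Rightarrow> 'b alg_closure" "q ^ n"
    by unfold_locales (rule field_embedding_to_ac, rule card_ext[symmetric])
  interpret L: finite_field_hom "\<lambda>x. to_ac (\<iota> x) :: 'b alg_closure" q
    by unfold_locales (rule field_embedding_to_ac_comp, rule q_eq)
  have KL: "K.lift (lift P) = L.lift P" by (simp add: map_poly_map_poly o_def)
  have Q: "lead_coeff Q = 1" "irreducible Q" using assms(3) by (auto dest: monic_primesD)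
  obtain \<alpha> where \<alpha>: "poly (K.lift Q) \<alpha> = 0"
    using alg_closure_root[of Q] degree_irreducible_pos[OF Q(2)] by auto
  have "K.lift Q dvd K.lift (lift P)" using monic_primesD(3)[OF assms(3)] by simp
  then have \<alpha>': "poly (L.lift P) \<alpha> = 0" using \<alpha> by (auto simp flip: KL)
  have iff: "degree Q dvd j \<longleftrightarrow> degree P dvd n * j" for j
    using K.frobenius_period[OF Q \<alpha>, of j] L.frobenius_period[OF assms(1,2) \<alpha>', of "n * j"]
    by (simp add: power_mult)
  define d g where "d = degree P" and "g = gcd n d"
  have "d > 0" using degree_irreducible_pos[OF assms(2)] by (simp add: d_def)
  then have "g > 0" by (simp add: g_def)
  obtain d' n' where dn: "d = d' * g" "n = n' * g" and cop: "coprime n' d'"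
    using gcd_coprime_exists[of n d] \<open>g > 0\<close> unfolding g_def by auto
  have "degree Q dvd d'" using iff[of d'] dn by (simp add: d_def[symmetric] mult.assoc mult.commute)
  moreover have "d' * g dvd (n' * degree Q) * g"
    using iff[of "degree Q"] dn by (simp add: d_def[symmetric] mult_ac)
  then have "d' dvd n' * degree Q" using \<open>g > 0\<close> by simp
  then have "d' dvd degree Q" using cop by (simp add: coprime_commute coprime_dvd_mult_right_iff)
  ultimately have "degree Q = d'" by (rule dvd_antisym)
  then show ?thesis using dn(1) by (simp add: d_def g_def)
qed

text \<open>The prime factors multiply to \<open>lift P\<close> and all have the same degree
  \<open>degree P div gcd n (degree P)\<close>.\<close>

lemma card_monic_primes_lift_prime:
  assumes "lead_coeff P = 1" "irreducible P"
  shows "card (monic_primes (lift P)) = gcd n (degree P)"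
proof -
  let ?g = "gcd n (degree P)"
  have d: "degree P > 0" using assms(2) by (rule degree_irreducible_pos)
  then have "?g > 0" by simp
  have "degree P = degree (poly_radical (lift P))"
    using poly_radical_lift_prime[OF assms] by simp
  also have "\<dots> = (\<Sum>Q\<in>monic_primes (lift P). degree Q)"
    unfolding poly_radical_def by (rule degree_prod_sum_eq) (rule monic_primesD)
  finally have "degree P * ?g = (\<Sum>Q\<in>monic_primes (lift P). degree Q * ?g)"
    by (metis sum_distrib_right)
  also have "\<dots> = (\<Sum>Q\<in>monic_primes (lift P). degree P)"
    by (intro sum.cong refl degree_prime_factor_lift[symmetric] assms)
  finally show ?thesis using d by simp
qed

text \<open>Shows that squarefreeness is unaffected by the extension, so both Moebius values vanish
  together.\<close>

lemma poly_radical_lift: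
  assumes "N \<noteq> 0"
  shows "poly_radical (lift N) = lift (poly_radical N)"
proof -
  have "poly_radical (lift N) = (\<Prod>P\<in>monic_primes N. poly_radical (lift P))"
    unfolding poly_radical_def monic_primes_lift[OF assms]
  proof (rule prod.UNION_disjoint)
    show "finite (monic_primes N)" using assms by (rule finite_monic_primes)
    show "\<forall>P\<in>monic_primes N. finite (monic_primes (lift P))"
      by (auto intro!: finite_monic_primes dest: monic_primesD(4))
  qed (use disjoint_monic_primes_lift in blast)
  also have "\<dots> = (\<Prod>P\<in>monic_primes N. lift P)"
    by (intro prod.cong refl poly_radical_lift_prime) (auto dest: monic_primesD)
  finally show ?thesis by (simp add: poly_radical_def lift_prod)
qed

lemma card_monic_primes_lift:
  assumes "N \<noteq> 0"
  shows "card (monic_primes (lift N)) = (\<Sum>P\<in>monic_primes N. gcd n (degree P))"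
proof -
  have "card (monic_primes (lift N)) = (\<Sum>P\<in>monic_primes N. card (monic_primes (lift P)))"
    unfolding monic_primes_lift[OF assms]
  proof (rule card_UN_disjoint)
    show "finite (monic_primes N)" using assms by (rule finite_monic_primes)
    show "\<forall>P\<in>monic_primes N. finite (monic_primes (lift P))"
      by (auto intro!: finite_monic_primes dest: monic_primesD(4))
  qed (use disjoint_monic_primes_lift in blast)
  also have "\<dots> = (\<Sum>P\<in>monic_primes N. gcd n (degree P))"
    by (intro sum.cong refl card_monic_primes_lift_prime) (auto dest: monic_primesD)
  finally show ?thesis .
qed

lemma moebius_lift:
  assumes "N \<noteq> 0"
  shows "(-1) ^ degree N * moebius (lift N) = ((-1) ^ degree N * moebius N) ^ n"
proof (cases "N dvd poly_radical N")
  case False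
  then have "moebius N = 0" "moebius (lift N) = 0"
    using poly_radical_lift[OF assms] by (simp_all add: moebius_def)
  then show ?thesis using n by (simp add: power_0_left)
next
  case True
  let ?Z = "monic_primes N"
  have "poly_radical N \<noteq> 0" using lead_coeff_poly_radical[of N] by auto
  then have "degree N = degree (poly_radical N)"
    using assms True poly_radical_dvd[OF finite_monic_primes[OF assms]]
    by (intro antisym dvd_imp_degree_le) auto
  also have "\<dots> = (\<Sum>P\<in>?Z. degree P)"
    unfolding poly_radical_def by (rule degree_prod_sum_eq) (rule monic_primesD)
  finally have deg: "degree N = (\<Sum>P\<in>?Z. degree P)" .
  \<comment> \<open>For odd \<open>d\<close> the gcd is odd and both sides are 1; for even
    \<open>d\<close> the gcd has the parity of \<open>n\<close>.\<close>
  have parity: "(-1) ^ d * (-1) ^ gcd n d = (((-1) ^ d * (-1)) ^ n :: complex)" for d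
    by (cases "even d"; cases "even n") (auto simp: gcd_nat.bounded_iff)
  have "(-1) ^ degree N * moebius (lift N) = (\<Prod>P\<in>?Z. (-1) ^ degree P * (-1) ^ gcd n (degree P))"
    using True poly_radical_lift[OF assms]
    by (simp add: moebius_def card_monic_primes_lift[OF assms] deg power_sum prod.distrib)
  also have "\<dots> = (\<Prod>P\<in>?Z. (-1) ^ degree P * (-1)) ^ n"
    unfolding parity by (rule prod_power_distrib[symmetric])
  also have "(\<Prod>P\<in>?Z. (-1) ^ degree P * (-1)) = (-1) ^ degree N * moebius N"
    unfolding deg prod.distrib using True by (simp add: moebius_def power_sum)
  finally show ?thesis .
qed

text \<open>By uniqueness the k-th root over the extension is fixed by Frobenius, so it descends;
  the universal properties over both fields then identify it with \<open>lift D\<close>.\<close>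

lemma kgcd_lift:
  assumes k: "k \<ge> 1" and B: "B \<noteq> 0" and D: "lead_coeff D = 1" "D ^ k = kgcd k A B"
  shows "lift D ^ k = kgcd k (lift A) (lift B)"
proof -
  obtain C where C: "lead_coeff C = 1" "kgcd k (lift A) (lift B) = C ^ k"
    "C ^ k dvd lift A" "C ^ k dvd lift B"
    "\<And>E. E ^ k dvd lift A \<Longrightarrow> E ^ k dvd lift B \<Longrightarrow> E dvd C"
    using kgcd_props[of k "lift B" "lift A"] k B by auto
  note D' = kgcd_root_props[OF k B D]
  interpret F: field_hom "\<lambda>z::'b. z ^ q"
    using frobenius_embedding[of 1] by unfold_locales simp
  have fix_lift: "F.lift (lift p) = lift p" for p
    using lift_power_q_power[of 1 p] by simp
  \<comment> \<open>\<open>lift A\<close> and \<open>lift B\<close> are fixed by Frobenius, so the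
    conjugate of \<open>C\<close> is again an admissible root.\<close>
  have "F.lift C dvd C"
  proof (rule C(5))
    have "F.lift (C ^ k) dvd F.lift (lift A)" "F.lift (C ^ k) dvd F.lift (lift B)"
      using C(3,4) by (simp_all only: F.lift_dvd_iff)
    then show "F.lift C ^ k dvd lift A" "F.lift C ^ k dvd lift B"
      by (simp_all only: fix_lift F.lift_power)
  qed
  then have "F.lift C = C" using C(1) by (intro monic_dvd_degree_imp_eq) auto
  then obtain T where T: "C = lift T" using lift_exists[of C] by blast
  have "T ^ k dvd A" "T ^ k dvd B"
    using C(3,4) unfolding T by (simp_all only: lift_dvd_iff flip: lift_power)
  then have "C dvd lift D" unfolding T using D'(3) by simp
  moreover have "lift D dvd C"
    using D'(1,2) by (intro C(5)) (simp_all only: lift_dvd_iff flip: lift_power)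
  ultimately have "lift D = C" using C(1) D(1) by (intro monic_dvd_antisym) auto
  then show ?thesis using C(2) by simp
qed

section \<open>The trace and the character it induces on the extension\<close>

definition trace :: "'b \<Rightarrow> 'a" where
  "trace c = (THE a. \<iota> a = (\<Sum>i=1..n. c ^ (q ^ i)))"

lemma power_card_ext: "(c::'b) ^ (q ^ n) = c"
  using finite_field_power_card_eq_same[of c] by (simp add: card_ext)

text \<open>Frobenius shifts the exponents \<open>1..n\<close> by one, and
  \<open>c ^ (q ^ Suc n) = c ^ q\<close> closes the cycle. The sum is therefore fixed and lies in
  the image of \<open>\<iota>\<close>.\<close>

lemma hom_trace: "\<iota> (trace c) = (\<Sum>i=1..n. c ^ (q ^ i))"
proof -
  let ?s = "\<lambda>c. \<Sum>i=1..n. c ^ (q ^ i)"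
  interpret F: field_hom "\<lambda>z::'b. z ^ q"
    using frobenius_embedding[of 1] by unfold_locales simp
  have "?s c ^ q = (\<Sum>i=1..n. c ^ (q ^ Suc i))"
    unfolding F.hom_sum by (simp add: mult.commute flip: power_mult)
  also have "\<dots> = (\<Sum>i=Suc 1..Suc n. c ^ (q ^ i))"
    by (rule sum.shift_bounds_cl_Suc_ivl[symmetric])
  also have "\<dots> + c ^ q = ?s c + c ^ (q ^ Suc n)"
    using sum.atLeast_Suc_atMost[of 1 n "\<lambda>i. c ^ (q ^ i)"] n by (simp add: add_ac)
  also have "c ^ (q ^ Suc n) = c ^ q"
    using power_card_ext by (simp add: power_mult mult.commute[of q])
  finally have "?s c ^ q = ?s c" by simp
  then obtain a where a: "\<iota> a = ?s c" using frobenius_fixed_iff by (metis imageE)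
  have "trace c = a"
    unfolding trace_def a[symmetric] by (rule the_equality) simp_all
  then show ?thesis using a by simp
qed

lemma trace_add: "trace (x + y) = trace x + trace y"
proof -
  have "(x + y) ^ (q ^ i) = x ^ (q ^ i) + y ^ (q ^ i)" for i
    using frobenius_embedding[of i] by (simp add: field_embedding_def)
  then have "\<iota> (trace (x + y)) = \<iota> (trace x + trace y)"
    by (simp only: hom_trace hom_add sum.distrib)
  then show ?thesis by (simp only: hom_eq_iff)
qed

lemma trace_hom_mult: "trace (\<iota> a * x) = a * trace x"
proof -
  have "\<iota> (trace (\<iota> a * x)) = \<iota> (a * trace x)"
    by (simp only: hom_trace hom_mult power_mult_distrib hom_power_q_power sum_distrib_left)
  then show ?thesis by (simp only: hom_eq_iff)
qed

text \<open>The trace is, up to a q-th power, a nonzero polynomial function of degree at most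
  \<open>q ^ (n - 1)\<close>, too small to vanish on all \<open>q ^ n\<close> elements.\<close>

lemma trace_nonzero: obtains c where "trace c \<noteq> 0"
proof -
  \<comment> \<open>The exponents start at 0 here, one less than in \<open>trace\<close>: this
    lowers the degree below \<open>q ^ n\<close>, and the term \<open>X\<close> shows that
    \<open>f\<close> is nonzero.\<close>
  define f :: "'b poly" where "f = (\<Sum>i<n. monom 1 (q ^ i))"
  have q1: "q > 1" using q_ge_2 by simp
  have "coeff f 1 = (\<Sum>i<n. if i = 0 then 1 else 0)"
    unfolding f_def coeff_sum using q1 by (intro sum.cong) auto
  also have "\<dots> = 1" using n by simp
  finally have f0: "f \<noteq> 0" by auto
  have "degree f \<le> q ^ (n - 1)"
    unfolding f_def
  proof (rule degree_sum_le)
    fix i assume "i \<in> {..<n}"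
    then have "q ^ i \<le> q ^ (n - 1)" using q1 by (intro power_increasing) auto
    then show "degree (monom (1::'b) (q ^ i)) \<le> q ^ (n - 1)"
      using degree_monom_le order_trans by blast
  qed simp
  also have "\<dots> < CARD('b)" unfolding card_ext using q1 n by (intro power_strict_increasing) auto
  finally have "card {c. poly f c = 0} < CARD('b)" using card_poly_roots_bound[OF f0] by simp
  then have "{c. poly f c = 0} \<noteq> UNIV" by auto
  then obtain c where c: "poly f c \<noteq> 0" by blast
  interpret F: field_hom "\<lambda>z::'b. z ^ q"
    using frobenius_embedding[of 1] by unfold_locales simp
  have "poly f c ^ q = (\<Sum>i<n. c ^ (q ^ Suc i))"
    unfolding f_def poly_sum poly_monom F.hom_sum by (simp add: mult.commute flip: power_mult)
  also have "\<dots> = \<iota> (trace c)"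
    unfolding hom_trace by (rule sum.reindex_bij_witness[of _ "\<lambda>i. i - 1" Suc]) auto
  finally have "trace c \<noteq> 0" using c by (auto simp: q1)
  then show ?thesis using that by blast
qed

text \<open>By linearity over the base field, one nonzero value makes the trace surjective.\<close>

lemma nontrivial_additive_character_trace:
  assumes "nontrivial_additive_character lam"
  shows "nontrivial_additive_character (\<lambda>c. lam (trace c))"
proof -
  obtain a where a: "lam a \<noteq> 1" using assms by (auto simp: nontrivial_additive_character_def)
  obtain c where c: "trace c \<noteq> 0" by (rule trace_nonzero)
  have "trace (\<iota> (a / trace c) * c) = a" using c by (simp only: trace_hom_mult) simp
  then have "\<exists>c. lam (trace c) \<noteq> 1" using a by metis
  then show ?thesis using assms by (auto simp: nontrivial_additive_character_def trace_add)
qed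

lemma funpow_frob: "(frob q ^^ i) D = map_poly (\<lambda>z::'b. z ^ (q ^ i)) D"
proof (induction i)
  case (Suc i)
  interpret F: field_hom "\<lambda>z::'b. z ^ (q ^ i)" by unfold_locales (rule frobenius_embedding)
  interpret F': field_hom "\<lambda>z::'b. z ^ (q ^ Suc i)" by unfold_locales (rule frobenius_embedding)
  interpret F1: field_hom "\<lambda>z::'b. z ^ q"
    using frobenius_embedding[of 1] by unfold_locales simp
  have "F1.lift (F.lift D) = F'.lift D"
    unfolding poly_eq_iff F1.coeff_lift F.coeff_lift F'.coeff_lift
    by (simp add: mult.commute flip: power_mult)
  then show ?case using Suc by (simp add: frob_def)
qed simp

text \<open>Applying \<open>trace\<close> to the coefficients provides the preimage that the
  description in \<open>poly_trace\<close> asks for.\<close>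

lemma lift_poly_trace:
  "lift (poly_trace \<iota> n D) = (\<Sum>i=1..n. map_poly (\<lambda>z. z ^ (q ^ i)) D)"
proof -
  let ?s = "\<Sum>i=1..n. map_poly (\<lambda>z. z ^ (q ^ i)) D"
  have trace0: "trace 0 = 0" using trace_hom_mult[of 0 0] by simp
  have "coeff ?s j = \<iota> (trace (coeff D j))" for j
    unfolding hom_trace coeff_sum
  proof (rule sum.cong[OF refl])
    fix i
    interpret F: field_hom "\<lambda>z::'b. z ^ (q ^ i)" by unfold_locales (rule frobenius_embedding)
    show "coeff (F.lift D) j = coeff D j ^ (q ^ i)" by (rule F.coeff_lift)
  qed
  then have eq: "lift (map_poly trace D) = ?s"
    by (simp add: poly_eq_iff coeff_map_poly trace0)
  have "poly_trace \<iota> n D = (THE T. lift T = ?s)"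
    unfolding poly_trace_def by (simp only: funpow_frob flip: q_eq)
  moreover have "(THE T. lift T = ?s) = map_poly trace D"
    unfolding eq[symmetric] by (rule the_equality) simp_all
  ultimately show ?thesis using eq by simp
qed

text \<open>As \<open>M\<close> and \<open>G\<close> have coefficients in the base field,
  \<open>t_coeff\<close> commutes with conjugation, so the trace may be taken after extracting the
  coefficient.\<close>

lemma t_coeff_poly_trace:
  "t_coeff M (G * poly_trace \<iota> n D) = trace (t_coeff (lift M) (lift G * D))"
proof -
  have add: "t_coeff (lift M) (sum f Y) = (\<Sum>i\<in>Y. t_coeff (lift M) (f i))"
    if "finite Y" for f and Y :: "nat set"
    using that by (induction Y rule: finite_induct) (auto simp: t_coeff_add, simp add: t_coeff_def)
  have conj: "t_coeff (lift M) (lift G * map_poly (\<lambda>z. z ^ (q ^ i)) D)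
      = t_coeff (lift M) (lift G * D) ^ (q ^ i)" for i
  proof -
    interpret F: field_hom "\<lambda>z::'b. z ^ (q ^ i)" by unfold_locales (rule frobenius_embedding)
    have "F.lift (lift G * D) = lift G * F.lift D"
      unfolding F.lift_mult lift_power_q_power ..
    then show ?thesis using F.t_coeff_lift[of "lift M" "lift G * D"] by (simp only: lift_power_q_power)
  qed
  have "\<iota> (t_coeff M (G * poly_trace \<iota> n D)) = t_coeff (lift M) (lift G * lift (poly_trace \<iota> n D))"
    by (simp only: t_coeff_lift[symmetric] lift_mult)
  also have "\<dots> = (\<Sum>i=1..n. t_coeff (lift M) (lift G * map_poly (\<lambda>z. z ^ (q ^ i)) D))"
    unfolding lift_poly_trace sum_distrib_left by (rule add) simp
  also have "\<dots> = \<iota> (trace (t_coeff (lift M) (lift G * D)))"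
    unfolding conj hom_trace ..
  finally show ?thesis by (simp only: hom_eq_iff)
qed

text \<open>This makes Hoelder's formula applicable over \<open>'b\<close>.\<close>

lemma eta_ext_eq: "eta_ext lam \<iota> n k S G H = eta (\<lambda>c. lam (trace c)) k S (lift G) (lift H)"
  unfolding eta_ext_def eta_def E_char_def t_coeff_poly_trace by simp

lemma phi_ext_eq: "phi_ext \<iota> n k H = phi k (lift H)"
  by (simp add: phi_ext_def phi_def pabs_def card_ext mult_ac flip: q_eq power_mult)

end

theorem theorem7p1:
  fixes \<iota> :: "'a::finite_field \<Rightarrow> 'b::finite_field"
    and lam :: "'a \<Rightarrow> complex"
    and k n m m\<^sub>1 :: nat
    and G H A N :: "'a poly"
    and R :: "'a poly set" and S :: "'b poly set"
  assumes "k \<ge> 1" and "n \<ge> 1"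
    and "CARD('b) = CARD('a) ^ n" and "field_embedding \<iota>"
    and "nontrivial_additive_character lam"
    and "H \<noteq> 0" and "\<not> H ^ k dvd G"
    and "complete_residue_system (H ^ k) R"
    and "complete_residue_system (map_poly \<iota> (H ^ k)) S"
    and "lead_coeff A = 1" and "A ^ k = kgcd k G (H ^ k)"
    and "N = H div A" and "m = degree H" and "m\<^sub>1 = degree A"
  shows "(-1) ^ (m - m\<^sub>1) * of_real (phi_ext \<iota> n k N / phi_ext \<iota> n k H) * eta_ext lam \<iota> n k S G H =
         ((-1) ^ (m - m\<^sub>1) * of_real (phi k N / phi k H) * eta lam k R G H) ^ n"
proof -
  interpret finite_field_ext \<iota> "CARD('a)" n
    using assms(2-4) by unfold_locales auto
  have M0: "H ^ k \<noteq> 0" using assms(6) by simp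
  \<comment> \<open>The division defining \<open>N\<close> is exact, because \<open>A ^ k\<close>
    divides \<open>H ^ k\<close>.\<close>
  have "A dvd H"
    using kgcd_root_props(2)[OF assms(1) M0 assms(10,11)]
    by (rule power_dvd_power_imp_dvd[OF assms(1,6)])
  then have N: "H = A * N" using assms(12) by simp
  then have nz: "A \<noteq> 0" "N \<noteq> 0" using assms(6) by auto
  have deg: "m - m\<^sub>1 = degree N" using assms(13,14) N nz by (simp add: degree_mult_eq)
  have "of_real (phi k N / phi k H) * eta lam k R G H = moebius N"
    using eta_hoelder[OF assms(1,5,6,8,10,11) N] phi_pos[OF assms(1), of H]
    by (simp add: field_simps)
  \<comment> \<open>The same formula with base field \<open>'b\<close> and the character composed
    with the trace; \<open>lift A\<close> is the required k-th root by descent.\<close>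
  moreover have "of_real (phi k (lift N)) * eta (\<lambda>c. lam (trace c)) k S (lift G) (lift H)
      = of_real (phi k (lift H)) * moebius (lift N)"
  proof (rule eta_hoelder[OF assms(1)])
    show "nontrivial_additive_character (\<lambda>c. lam (trace c))"
      using assms(5) by (rule nontrivial_additive_character_trace)
    show "complete_residue_system (lift H ^ k) S" using assms(9) by simp
    show "lift A ^ k = kgcd k (lift G) (lift H ^ k)"
      using kgcd_lift[OF assms(1) M0 assms(10,11)] by simp
    show "lift H = lift A * lift N" using N by (simp flip: lift_mult)
  qed (use assms(6,10) in auto)
  then have "of_real (phi_ext \<iota> n k N / phi_ext \<iota> n k H) * eta_ext lam \<iota> n k S G H
      = moebius (lift N)"
    unfolding phi_ext_eq eta_ext_eq using phi_pos[OF assms(1), of "lift H"]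
    by (simp add: field_simps)
  ultimately show ?thesis
    using moebius_lift[OF nz(2)] by (simp only: deg mult.assoc)
qed

end
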